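(* Let $P,Q$ be finite posets and let $Q' \subseteq Q$ be a subposet. (a) If $Q'$ has a unique minimal element, then $\operatorname{lin}(\mathbb{K}[P,Q]) \geq \overline{\mathfrak{a}}(P)\cdot(|Q'|-1)+1$. (b) If $Q'$ has a unique maximal element, then $\operatorname{lin}(\mathbb{K}[P,Q]) \geq \underline{\mathfrak{a}}(P)\cdot(|Q'|-1)+1$. (c) If $Q'$ is bounded, then $\operatorname{lin}(\mathbb{K}[P,Q]) \geq \mathfrak{a}(P)\cdot(|Q'|-1)+1$.
   Context: All posets are finite and nonempty; subposets carry the induced order; $\mathbb{K}$ is an arbitrary field. $\operatorname{Hom}(P,Q)$ is the set of order-preserving maps $P\to Q$. $S_{P,Q}=\mathbb{K}[x_{p,q} : p\in P, q\in Q]$, $u_\phi=\prod_{p\in P}x_{p,\phi(p)}$, $L(P,Q)=(u_\phi : \phi\in \operatorname{Hom}(P,Q))\subseteq S_{P,Q}$ and $\mathbb{K}[P,Q]=S_{P,Q}/L(P,Q)$. $\mathfrak{a}(P)$ is the maximal cardinality of an antichain in $P$, $\overline{\mathfrak{a}}(P)$ is the number of maximal elements of $P$, and $\underline{\mathfrak{a}}(P)$ is the number of minimal elements of $P$. A poset is bounded if it has both a unique minimal and a unique maximal element. For a monomial ideal $I$ in a polynomial ring $S$ over $\mathbb{K}$ whose minimal generators have minimal degree $d$, the length of the linear strand of $S/I$ is $\operatorname{lin}(S/I)=\max\{i : \beta^S_{i,i+d-1}(S/I)\neq 0\}$, where $\beta^S_{i,j}(S/I)=\dim_{\mathbb K}\operatorname{Tor}_i^S(S/I,\mathbb{K})_j$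 (all variables of degree 1). For $L(P,Q)$ one has $d=|P|$. *)

theory Defs
  imports Complex_Main "HOL-Library.Poly_Mapping"
begin

section \<open>Polynomials\<close>

text \<open>The polynomial ring over \<open>'k\<close> with variables indexed by \<open>'v\<close>; a monomial is its
  exponent vector, of type \<open>'v \<Rightarrow>\<^sub>0 nat\<close>. Note that the library order on
  \<open>'v \<Rightarrow>\<^sub>0 nat\<close> is lexicographic, so it is not used for divisibility.\<close>

type_synonym ('v, 'k) mpoly = "('v \<Rightarrow>\<^sub>0 nat) \<Rightarrow>\<^sub>0 'k"

definition var :: "'v \<Rightarrow> ('v, 'k::field) mpoly" where
  "var v = Poly_Mapping.single (Poly_Mapping.single v 1) 1"

definition mdeg :: "('v \<Rightarrow>\<^sub>0 nat) \<Rightarrow> nat" where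
  "mdeg m = (\<Sum>v\<in>Poly_Mapping.keys m. Poly_Mapping.lookup m v)"

definition homogeneous :: "nat \<Rightarrow> ('v, 'k::field) mpoly \<Rightarrow> bool" where
  "homogeneous n f \<longleftrightarrow> (\<forall>m\<in>Poly_Mapping.keys f. mdeg m = n)"

definition ideal_gen :: "'r::comm_ring_1 set \<Rightarrow> 'r set" where
  "ideal_gen B = module.span (*) B"

lemma module_times: "module ((*) :: 'r::comm_ring_1 \<Rightarrow> 'r \<Rightarrow> 'r)"
  by unfold_locales (simp_all add: algebra_simps)

definition monomials_in :: "('v, 'k::field) mpoly set \<Rightarrow> ('v \<Rightarrow>\<^sub>0 nat) set" where
  "monomials_in I = {m. Poly_Mapping.single m 1 \<in> I}"

text \<open>The minimal monomial generators of a monomial ideal are the monomials of the ideal that are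
  minimal with respect to divisibility.\<close>

definition min_gens :: "('v, 'k::field) mpoly set \<Rightarrow> ('v \<Rightarrow>\<^sub>0 nat) set" where
  "min_gens I = {m \<in> monomials_in I. \<forall>m'\<in>monomials_in I. (\<exists>e. m = m' + e) \<longrightarrow> m' = m}"

definition min_gen_degree :: "('v, 'k::field) mpoly set \<Rightarrow> nat" where
  "min_gen_degree I = (LEAST n. \<exists>m\<in>min_gens I. mdeg m = n)"


section \<open>Graded free resolutions and Betti numbers\<close>

text \<open>Elements of a free module \<open>R\<^sup>(\<^sup>B\<^sup>)\<close> with basis \<open>B\<close> of natural numbers are finitely supported
  functions \<open>nat \<Rightarrow>\<^sub>0 'r\<close> with support in \<open>B\<close>.\<close>

definition smul :: "'r::comm_ring_1 \<Rightarrow> (nat \<Rightarrow>\<^sub>0 'r) \<Rightarrow> (nat \<Rightarrow>\<^sub>0 'r)" where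
  "smul c v = Poly_Mapping.map ((*) c) v"

definition lincomb :: "(nat \<Rightarrow> (nat \<Rightarrow>\<^sub>0 'r::comm_ring_1)) \<Rightarrow> (nat \<Rightarrow>\<^sub>0 'r) \<Rightarrow> (nat \<Rightarrow>\<^sub>0 'r)" where
  "lincomb d v = (\<Sum>k\<in>Poly_Mapping.keys v. smul (Poly_Mapping.lookup v k) (d k))"

definition free_on :: "nat set \<Rightarrow> (nat \<Rightarrow>\<^sub>0 'r::zero) set" where
  "free_on B = {v. Poly_Mapping.keys v \<subseteq> B}"

lemma lookup_smul: "Poly_Mapping.lookup (smul c v) k = c * Poly_Mapping.lookup v k"
  by (simp add: smul_def Poly_Mapping.map.rep_eq when_def)

lemma vector_space_smul: "vector_space (smul :: 'k::field \<Rightarrow> (nat \<Rightarrow>\<^sub>0 'k) \<Rightarrow> (nat \<Rightarrow>\<^sub>0 'k))"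
  by unfold_locales
    (auto intro!: poly_mapping_eqI simp: lookup_smul lookup_add algebra_simps)

text \<open>A complex of graded free modules \<open>F\<^sub>0 \<leftarrow> F\<^sub>1 \<leftarrow> \<dots>\<close> with an augmentation. The basis element
  \<open>k \<in> basis F i\<close> of \<open>F\<^sub>i\<close> has degree \<open>bdeg F i k\<close>; it is mapped to \<open>diff F i k \<in> F\<^sub>i\<^sub>-\<^sub>1\<close> if
  \<open>i \<ge> 1\<close> (\<open>diff F 0\<close> is irrelevant), and \<open>k \<in> basis F 0\<close> is mapped by the augmentation to the
  residue class of \<open>aug F k\<close> in \<open>S/I\<close>.\<close>

record (overloaded) ('v, 'k) graded_free_complex =
  basis :: "nat \<Rightarrow> nat set"
  bdeg :: "nat \<Rightarrow> nat \<Rightarrow> nat"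
  diff :: "nat \<Rightarrow> nat \<Rightarrow> (nat \<Rightarrow>\<^sub>0 (('v \<Rightarrow>\<^sub>0 nat) \<Rightarrow>\<^sub>0 'k))"
  aug :: "nat \<Rightarrow> (('v \<Rightarrow>\<^sub>0 nat) \<Rightarrow>\<^sub>0 'k)"

definition aug_map ::
    "('v, 'k::field) graded_free_complex \<Rightarrow> (nat \<Rightarrow>\<^sub>0 ('v, 'k) mpoly) \<Rightarrow> ('v, 'k) mpoly" where
  "aug_map F v = (\<Sum>k\<in>Poly_Mapping.keys v. Poly_Mapping.lookup v k * aug F k)"

text \<open>\<open>F\<close> is a graded free resolution of \<open>S/I\<close> over \<open>S\<close>, with finitely many basis elements in
  each homological and internal degree. All maps have degree 0: a nonzero coefficient at
  \<open>l\<close> of the image of the basis element \<open>k\<close> is homogeneous of degree \<open>deg k - deg l\<close>.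
  The last three conditions are surjectivity of \<open>F\<^sub>0 \<rightarrow> S/I\<close>, exactness at \<open>F\<^sub>0\<close>, and exactness
  at \<open>F\<^sub>i\<close> for \<open>i \<ge> 1\<close>.\<close>

definition graded_free_resolution ::
    "('v, 'k::field) mpoly set \<Rightarrow> ('v, 'k) graded_free_complex \<Rightarrow> bool" where
  "graded_free_resolution I F \<longleftrightarrow>
     (\<forall>i j. finite {k \<in> basis F i. bdeg F i k = j}) \<and>
     (\<forall>k\<in>basis F 0. homogeneous (bdeg F 0 k) (aug F k)) \<and>
     (\<forall>i. \<forall>k\<in>basis F (Suc i). diff F (Suc i) k \<in> free_on (basis F i) \<and>
        (\<forall>l. \<forall>m\<in>Poly_Mapping.keys (Poly_Mapping.lookup (diff F (Suc i) k) l).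
           mdeg m + bdeg F i l = bdeg F (Suc i) k)) \<and>
     (\<forall>f. \<exists>v\<in>free_on (basis F 0). f - aug_map F v \<in> I) \<and>
     lincomb (diff F 1) ` free_on (basis F 1) = {v \<in> free_on (basis F 0). aug_map F v \<in> I} \<and>
     (\<forall>i\<ge>1. lincomb (diff F (Suc i)) ` free_on (basis F (Suc i)) =
        {v \<in> free_on (basis F i). lincomb (diff F i) v = 0})"

text \<open>Applying \<open>\<otimes>\<^sub>S K\<close>, with \<open>K = S/(x\<^sub>v)\<^sub>v\<close>, to \<open>F\<close> gives the complex of graded \<open>K\<close>-vector
  spaces with the same bases, whose matrices consist of the constant coefficients of the
  matrices of \<open>F\<close>.\<close>

definition diff_K ::
    "('v, 'k::field) graded_free_complex \<Rightarrow> nat \<Rightarrow> (nat \<Rightarrow>\<^sub>0 'k) \<Rightarrow> (nat \<Rightarrow>\<^sub>0 'k)" where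
  "diff_K F i = lincomb (\<lambda>k. Poly_Mapping.map (\<lambda>f. Poly_Mapping.lookup f 0) (diff F i k))"

definition comp_K :: "('v, 'k::field) graded_free_complex \<Rightarrow> nat \<Rightarrow> nat \<Rightarrow> (nat \<Rightarrow>\<^sub>0 'k) set" where
  "comp_K F i j = free_on {k \<in> basis F i. bdeg F i k = j}"

definition cycles_K :: "('v, 'k::field) graded_free_complex \<Rightarrow> nat \<Rightarrow> nat \<Rightarrow> (nat \<Rightarrow>\<^sub>0 'k) set" where
  "cycles_K F i j = {w \<in> comp_K F i j. i = 0 \<or> diff_K F i w = 0}"

definition boundaries_K :: "('v, 'k::field) graded_free_complex \<Rightarrow> nat \<Rightarrow> nat \<Rightarrow> (nat \<Rightarrow>\<^sub>0 'k) set" where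
  "boundaries_K F i j = diff_K F (Suc i) ` comp_K F (Suc i) j"

text \<open>The dimension of the degree \<open>j\<close> part of the homology of \<open>F \<otimes>\<^sub>S K\<close> in homological
  degree \<open>i\<close>; for a resolution both subspaces are finite-dimensional and the boundaries
  are contained in the cycles.\<close>

definition tor_dim :: "('v, 'k::field) graded_free_complex \<Rightarrow> nat \<Rightarrow> nat \<Rightarrow> nat" where
  "tor_dim F i j = vector_space.dim smul (cycles_K F i j) - vector_space.dim smul (boundaries_K F i j)"

text \<open>\<open>betti I i j\<close> is the dimension of the degree \<open>j\<close> part of \<open>Tor\<^sub>i(S/I, K)\<close>, computed
  from some graded free resolution of \<open>S/I\<close>; it does not depend on the choice.\<close>

definition betti :: "('v, 'k::field) mpoly set \<Rightarrow> nat \<Rightarrow> nat \<Rightarrow> nat" where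
  "betti I i j = tor_dim (SOME F. graded_free_resolution I F) i j"

text \<open>The length of the linear strand of \<open>S/I\<close>, for a nonzero proper monomial ideal \<open>I\<close>
  (so that \<open>min_gen_degree I \<ge> 1\<close> and the subtraction does not truncate).\<close>

definition lin :: "('v, 'k::field) mpoly set \<Rightarrow> nat" where
  "lin I = Max {i. betti I i (i + min_gen_degree I - 1) \<noteq> 0}"


section \<open>Posets and the ideal of order-preserving maps\<close>

definition minimal_elems :: "'a::order set \<Rightarrow> 'a set" where
  "minimal_elems A = {x \<in> A. \<forall>y\<in>A. y \<le> x \<longrightarrow> y = x}"

definition maximal_elems :: "'a::order set \<Rightarrow> 'a set" where
  "maximal_elems A = {x \<in> A. \<forall>y\<in>A. x \<le> y \<longrightarrow> y = x}"

definition bounded_poset :: "'a::order set \<Rightarrow> bool" where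
  "bounded_poset A \<longleftrightarrow> (\<exists>!x. x \<in> minimal_elems A) \<and> (\<exists>!x. x \<in> maximal_elems A)"

definition antichain :: "'a::order set \<Rightarrow> bool" where
  "antichain A \<longleftrightarrow> (\<forall>x\<in>A. \<forall>y\<in>A. x \<le> y \<longrightarrow> x = y)"

definition max_antichain_card :: "'a::{finite,order} set \<Rightarrow> nat" where
  "max_antichain_card P = Max {card A | A. A \<subseteq> P \<and> antichain A}"

text \<open>The posets \<open>P\<close> and \<open>Q\<close> are the types \<open>'p\<close> and \<open>'q\<close>; the variable \<open>x\<^sub>p\<^sub>,\<^sub>q\<close> is indexed by
  \<open>(p, q)\<close>.\<close>

definition u_mono :: "('p::{finite,order} \<Rightarrow> 'q::{finite,order}) \<Rightarrow> ('p \<times> 'q, 'k::field) mpoly" where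
  "u_mono \<phi> = (\<Prod>p\<in>UNIV. var (p, \<phi> p))"

definition hom_ideal :: "('p::{finite,order} \<times> 'q::{finite,order}, 'k::field) mpoly set" where
  "hom_ideal = ideal_gen {u_mono \<phi> | \<phi>. mono \<phi>}"

end

theory Submission
  imports Defs "HOL-Library.Function_Algebras" "HOL-Library.Countable" "HOL-Library.FuncSet"
begin

text \<open>Let \<open>d = |P|\<close>. A nonzero Koszul cycle in \<open>\<And>\<^sup>iV \<otimes> I\<^sub>d\<close>, where \<open>I = L(P, Q)\<close> and \<open>V\<close> is spanned by
  the variables, is the boundary of some \<open>z\<close> in \<open>\<And>\<^sup>i\<^sup>+\<^sup>1V \<otimes> S\<^sub>d\<^sub>-\<^sub>1\<close>, which is then a cycle over
  \<open>S/I\<close> but not a boundary, because \<open>I\<close> lives in degrees at least \<open>d\<close>. It therefore witnesses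
  \<open>\<beta>\<^sub>i\<^sub>+\<^sub>1\<^sub>,\<^sub>i\<^sub>+\<^sub>d \<noteq> 0\<close>. Such a cycle arises from an antichain \<open>A\<close> of \<open>P\<close> and a map \<open>g\<close> on the complement of
  \<open>A\<close> such that every map \<open>A \<rightarrow> Q'\<close> together with \<open>g\<close> is order-preserving: it is the product, over
  \<open>p \<in> A\<close>, of the Koszul boundaries of the wedge of all \<open>x\<^sub>p\<^sub>,\<^sub>q\<close> with \<open>q \<in> Q'\<close>, times the
  monomial of \<open>g\<close>, and has \<open>i = |A| (|Q'| - 1)\<close>. For (a) and (b), \<open>A\<close> consists of the maximal
  (minimal) elements; for (c), \<open>g\<close> sends the elements below \<open>A\<close> to the bottom and all others to the
  top of \<open>Q'\<close>.

  Since \<open>betti\<close> refers to an arbitrary graded free resolution \<open>F\<close>, homology of \<open>F \<otimes> K\<close> is compared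
  with Koszul homology by zigzags in the double complex \<open>F \<otimes> \<And>V\<close>. The same zigzags show that the Betti
  numbers vanish beyond the number of variables, so that the maximum in \<open>lin\<close> is over a finite set.\<close>

section \<open>Polynomials and their homogeneous components\<close>

abbreviation lookup :: "('a \<Rightarrow>\<^sub>0 'b::zero) \<Rightarrow> 'a \<Rightarrow> 'b" where
  "lookup \<equiv> Poly_Mapping.lookup"

abbreviation keys :: "('a \<Rightarrow>\<^sub>0 'b::zero) \<Rightarrow> 'a set" where
  "keys \<equiv> Poly_Mapping.keys"

abbreviation single :: "'a \<Rightarrow> 'b \<Rightarrow> ('a \<Rightarrow>\<^sub>0 'b::zero)" where
  "single \<equiv> Poly_Mapping.single"

lemma lookup_single_times:
  fixes f :: "('v \<Rightarrow>\<^sub>0 nat) \<Rightarrow>\<^sub>0 'k::comm_ring_1"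
  shows "lookup (single a c * f) m = (if \<exists>m'. m = a + m' then c * lookup f (m - a) else 0)"
proof -
  have "lookup (single a c * f) m = c * (Sum_any (\<lambda>q. lookup f q when m = a + q))"
    by (simp add: lookup_mult lookup_single when_mult)
  also have "\<dots> = (if \<exists>m'. m = a + m' then c * lookup f (m - a) else 0)"
  proof (cases "\<exists>m'. m = a + m'")
    case True
    then obtain m' where m: "m = a + m'" by blast
    have "(\<lambda>q. lookup f q when m = a + q) = (\<lambda>q. lookup f q when q = m')"
      using m by (auto simp: when_def)
    then show ?thesis using m by auto
  qed auto
  finally show ?thesis .
qed

lemma lookup_times_0:
  fixes f g :: "('v \<Rightarrow>\<^sub>0 nat) \<Rightarrow>\<^sub>0 'k::comm_ring_1"
  shows "lookup (f * g) 0 = lookup f 0 * lookup g 0"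
proof -
  have z: "(0 = l + q) \<longleftrightarrow> l = 0 \<and> q = 0" for l q :: "'v \<Rightarrow>\<^sub>0 nat"
    by (auto simp: poly_mapping_eq_iff fun_eq_iff lookup_add)
  have "lookup (f * g) 0 = (Sum_any (\<lambda>l. lookup f l * Sum_any (\<lambda>q. lookup g q when l = 0 when q = 0)))"
    by (simp add: lookup_mult z when_when conj_commute)
  also have "\<dots> = Sum_any (\<lambda>l. lookup f l * lookup g 0 when l = 0)"
    by (rule Sum_any.cong) (auto simp: when_def)
  finally show ?thesis by simp
qed

lemma poly_mapping_expand: "f = (\<Sum>m\<in>keys f. single m (lookup f m))"
  by (rule poly_mapping_eqI) (auto simp: lookup_sum lookup_single when_def in_keys_iff)

lemma mdeg_UNIV: "mdeg m = (\<Sum>v\<in>UNIV. lookup m v)" for m :: "'v::finite \<Rightarrow>\<^sub>0 nat"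
  unfolding mdeg_def by (rule sum.mono_neutral_left) (auto simp: in_keys_iff)

lemma mdeg_add: "mdeg (a + b) = mdeg a + mdeg b" for a b :: "'v::finite \<Rightarrow>\<^sub>0 nat"
  by (simp add: mdeg_UNIV lookup_add sum.distrib)

lemma mdeg_0 [simp]: "mdeg 0 = 0"
  by (simp add: mdeg_def)

lemma mdeg_single [simp]: "mdeg (single v k) = k"
  by (simp add: mdeg_def)

lemma mdeg_eq_0_iff: "mdeg m = 0 \<longleftrightarrow> m = 0" for m :: "'v::finite \<Rightarrow>\<^sub>0 nat"
  by (simp add: mdeg_UNIV poly_mapping_eq_iff fun_eq_iff)

lemma finite_mdeg_le: "finite {m :: 'v::finite \<Rightarrow>\<^sub>0 nat. mdeg m \<le> n}"
proof (rule finite_subset)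
  show "{m :: 'v \<Rightarrow>\<^sub>0 nat. mdeg m \<le> n} \<subseteq> Abs_poly_mapping ` (PiE UNIV (\<lambda>_. {..n}))"
  proof
    fix m :: "'v \<Rightarrow>\<^sub>0 nat" assume "m \<in> {m. mdeg m \<le> n}"
    then have m: "(\<Sum>v\<in>UNIV. lookup m v) \<le> n" by (simp add: mdeg_UNIV)
    have "lookup m v \<le> n" for v
      using member_le_sum[of v UNIV "lookup m"] m by simp
    then have "lookup m \<in> PiE UNIV (\<lambda>_. {..n})" by (simp add: PiE_iff)
    then show "m \<in> Abs_poly_mapping ` (PiE UNIV (\<lambda>_. {..n}))"
      by (metis imageI lookup_inverse)
  qed
qed (simp add: finite_PiE)

text \<open>The degree is an integer so that shifts such as \<open>n - e\<close> never truncate. The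
  equation \<open>hcomp n f = f\<close> serves below as homogeneity of degree \<open>n\<close>; zero
  satisfies it for every \<open>n\<close>.\<close>

definition hcomp :: "int \<Rightarrow> ('v, 'k::field) mpoly \<Rightarrow> ('v, 'k) mpoly" where
  "hcomp n f = (\<Sum>m\<in>{m \<in> keys f. int (mdeg m) = n}. single m (lookup f m))"

lemma lookup_hcomp: "lookup (hcomp n f) m = (if int (mdeg m) = n then lookup f m else 0)"
  by (auto simp: hcomp_def lookup_sum lookup_single when_def in_keys_iff)

lemma hcomp_0 [simp]: "hcomp n 0 = 0"
  by (simp add: hcomp_def)

lemma hcomp_add: "hcomp n (f + g) = hcomp n f + hcomp n g"
  by (rule poly_mapping_eqI) (simp add: lookup_hcomp lookup_add)

lemma hcomp_diff: "hcomp n (f - g) = hcomp n f - hcomp n g"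
  by (rule poly_mapping_eqI) (simp add: lookup_hcomp lookup_minus)

lemma hcomp_sum: "hcomp n (sum f A) = (\<Sum>x\<in>A. hcomp n (f x))"
  by (induction A rule: infinite_finite_induct) (auto simp: hcomp_add)

lemma hcomp_hcomp [simp]: "hcomp n (hcomp n f) = hcomp n f"
  by (rule poly_mapping_eqI) (simp add: lookup_hcomp)

lemma hcomp_eq_iff: "hcomp n f = f \<longleftrightarrow> (\<forall>m\<in>keys f. int (mdeg m) = n)"
  by (auto simp: poly_mapping_eq_iff fun_eq_iff lookup_hcomp in_keys_iff)

text \<open>In the convolution formula for the coefficient at \<open>m\<close>, a monomial
  \<open>l\<close> of \<open>c\<close> contributes only if \<open>mdeg m = mdeg l + e\<close>, since
  all monomials of \<open>b\<close> have degree \<open>e\<close>.\<close>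

lemma hcomp_mult:
  fixes b c :: "('v::finite, 'k::field) mpoly"
  assumes "hcomp e b = b"
  shows "hcomp n (c * b) = hcomp (n - e) c * b"
proof (rule poly_mapping_eqI)
  fix m
  define X where "X l = Sum_any (\<lambda>q. lookup b q when m = l + q)" for l
  have X: "X l = 0" if ne: "int (mdeg m) \<noteq> int (mdeg l) + e" for l
  proof (rule ccontr)
    assume nz: "X l \<noteq> 0"
    obtain q where "(lookup b q when m = l + q) \<noteq> 0"
      using nz unfolding X_def by (rule Sum_any.not_neutral_obtains_not_neutral)
    then show False using assms ne by (auto simp: hcomp_eq_iff mdeg_add in_keys_iff when_def split: if_splits)
  qed
  have "lookup (hcomp (n - e) c * b) m =
      Sum_any (\<lambda>l. if int (mdeg m) = n then lookup c l * X l else 0)"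
    unfolding lookup_mult X_def[symmetric] by (rule Sum_any.cong) (auto simp: lookup_hcomp intro!: X)
  also have "\<dots> = lookup (hcomp n (c * b)) m"
    by (simp add: lookup_hcomp lookup_mult X_def)
  finally show "lookup (hcomp n (c * b)) m = lookup (hcomp (n - e) c * b) m" ..
qed

lemma hcomp_eq_mult:
  fixes b c :: "('v::finite, 'k::field) mpoly"
  assumes "hcomp e b = b" "hcomp e' c = c"
  shows "hcomp (e' + e) (c * b) = c * b"
  using hcomp_mult[OF assms(1), of "e' + e" c] assms(2) by simp

lemma hcomp_single: "hcomp (int (mdeg m)) (single m c) = single m c"
  by (auto simp: hcomp_eq_iff)

lemma hcomp_var: "hcomp 1 (var v :: ('v, 'k::field) mpoly) = var v"
  by (auto simp: hcomp_eq_iff var_def)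

lemma hcomp_neg: "n < 0 \<Longrightarrow> hcomp n f = 0"
  by (rule poly_mapping_eqI) (auto simp: lookup_hcomp)

lemma hcomp_sign: "hcomp 0 ((-1) ^ n :: ('v, 'k::field) mpoly) = (-1) ^ n"
  by (cases "even n") (auto intro!: poly_mapping_eqI simp: lookup_hcomp lookup_one when_def)

section \<open>Maps of free modules\<close>

lemma smul_add: "smul c (v + w) = smul c v + smul c w"
  by (rule poly_mapping_eqI) (simp add: lookup_smul lookup_add algebra_simps)

lemma smul_diff: "smul c (v - w) = smul c v - smul c w"
  by (rule poly_mapping_eqI) (simp add: lookup_smul lookup_minus algebra_simps)

lemma smul_add_left: "smul (c + d) v = smul c v + smul d v"
  by (rule poly_mapping_eqI) (simp add: lookup_smul lookup_add algebra_simps)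

lemma smul_smul: "smul c (smul d v) = smul (c * d) v"
  by (rule poly_mapping_eqI) (simp add: lookup_smul algebra_simps)

lemma smul_0 [simp]: "smul 0 v = 0" "smul c 0 = 0"
  by (rule poly_mapping_eqI, simp add: lookup_smul)+

lemma smul_1 [simp]: "smul 1 v = v"
  by (rule poly_mapping_eqI) (simp add: lookup_smul)

lemma smul_sum: "smul c (sum f A) = (\<Sum>x\<in>A. smul c (f x))"
  by (induction A rule: infinite_finite_induct) (auto simp: smul_add)

lemma free_on_iff: "v \<in> free_on B \<longleftrightarrow> (\<forall>k. k \<notin> B \<longrightarrow> lookup v k = 0)"
  by (auto simp: free_on_def in_keys_iff)

lemma free_on_0 [simp]: "0 \<in> free_on B"
  by (simp add: free_on_iff)

lemma free_on_add: "v \<in> free_on B \<Longrightarrow> w \<in> free_on B \<Longrightarrow> v + w \<in> free_on B"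
  by (simp add: free_on_iff lookup_add)

lemma free_on_diff: "v \<in> free_on B \<Longrightarrow> w \<in> free_on B \<Longrightarrow> v - w \<in> free_on B"
  for v :: "nat \<Rightarrow>\<^sub>0 'r::ab_group_add"
  by (simp add: free_on_iff lookup_minus)

lemma free_on_smul: "v \<in> free_on B \<Longrightarrow> smul c v \<in> free_on B"
  by (simp add: free_on_iff lookup_smul)

lemma free_on_sum: "(\<And>x. x \<in> A \<Longrightarrow> f x \<in> free_on B) \<Longrightarrow> sum f A \<in> free_on B"
  by (induction A rule: infinite_finite_induct) (auto simp: free_on_add)

lemma lincomb_superset:
  assumes "finite A" "keys v \<subseteq> A"
  shows "lincomb d v = (\<Sum>k\<in>A. smul (lookup v k) (d k))"
  unfolding lincomb_def using assms
  by (intro sum.mono_neutral_left) (auto simp: in_keys_iff)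

lemma lincomb_add: "lincomb d (v + w) = lincomb d v + lincomb d w"
proof -
  let ?A = "keys v \<union> keys w"
  have "keys (v + w) \<subseteq> ?A" by (rule keys_add)
  then show ?thesis
    by (simp add: lincomb_superset[of ?A] lookup_add smul_add_left sum.distrib)
qed

lemma lincomb_smul: "lincomb d (smul c v) = smul c (lincomb d v)"
proof -
  have "keys (smul c v) \<subseteq> keys v" by (auto simp: in_keys_iff lookup_smul)
  then show ?thesis
    by (simp add: lincomb_superset[of "keys v"] lookup_smul smul_sum smul_smul)
qed

lemma lincomb_0 [simp]: "lincomb d 0 = 0"
  by (simp add: lincomb_def)

lemma lincomb_diff: "lincomb d (v - w) = lincomb d v - lincomb d w"
  using lincomb_add[of d "v - w" w] by simp

lemma lincomb_sum: "lincomb d (sum f A) = (\<Sum>x\<in>A. lincomb d (f x))"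
  by (induction A rule: infinite_finite_induct) (auto simp: lincomb_add)

lemma lincomb_single [simp]: "lincomb d (single k c) = smul c (d k)"
  by (simp add: lincomb_def)

lemma lookup_lincomb: "lookup (lincomb d v) l = (\<Sum>k\<in>keys v. lookup v k * lookup (d k) l)"
  by (simp add: lincomb_def lookup_sum lookup_smul)

lemma lincomb_in_free_on:
  assumes "v \<in> free_on B'" "\<And>k. k \<in> B' \<Longrightarrow> d k \<in> free_on B"
  shows "lincomb d v \<in> free_on B"
  unfolding lincomb_def using assms by (intro free_on_sum free_on_smul) (auto simp: free_on_def)

text \<open>Viewing the augmentation as a map into a free module of rank one lets it inherit
  linearity and compatibility with gradings from \<open>lincomb\<close>.\<close>

lemma aug_map_conv_lincomb: "aug_map F v = lookup (lincomb (\<lambda>k. single 0 (aug F k)) v) 0"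
  by (simp add: aug_map_def lookup_lincomb)

lemma aug_map_add: "aug_map F (v + w) = aug_map F v + aug_map F w"
  by (simp add: aug_map_conv_lincomb lincomb_add lookup_add)

lemma aug_map_smul: "aug_map F (smul c v) = c * aug_map F v"
  by (simp add: aug_map_conv_lincomb lincomb_smul lookup_smul)

lemma aug_map_0 [simp]: "aug_map F 0 = 0"
  by (simp add: aug_map_conv_lincomb)

lemma aug_map_sum: "aug_map F (sum f A) = (\<Sum>x\<in>A. aug_map F (f x))"
  by (induction A rule: infinite_finite_induct) (auto simp: aug_map_add)

section \<open>Graded components in free modules\<close>

definition gcomp ::
    "(nat \<Rightarrow> nat) \<Rightarrow> int \<Rightarrow> (nat \<Rightarrow>\<^sub>0 ('v, 'k::field) mpoly) \<Rightarrow> (nat \<Rightarrow>\<^sub>0 ('v, 'k) mpoly)" where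
  "gcomp dg n v = (\<Sum>k\<in>keys v. single k (hcomp (n - int (dg k)) (lookup v k)))"

lemma lookup_gcomp: "lookup (gcomp dg n v) k = hcomp (n - int (dg k)) (lookup v k)"
  by (auto simp: gcomp_def lookup_sum lookup_single when_def in_keys_iff)

lemma gcomp_gcomp [simp]: "gcomp dg n (gcomp dg n v) = gcomp dg n v"
  by (rule poly_mapping_eqI) (simp add: lookup_gcomp)

lemma gcomp_add: "gcomp dg n (v + w) = gcomp dg n v + gcomp dg n w"
  by (rule poly_mapping_eqI) (simp add: lookup_gcomp lookup_add hcomp_add)

lemma gcomp_diff: "gcomp dg n (v - w) = gcomp dg n v - gcomp dg n w"
  by (rule poly_mapping_eqI) (simp add: lookup_gcomp lookup_minus hcomp_diff)

lemma gcomp_0 [simp]: "gcomp dg n 0 = 0"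
  by (rule poly_mapping_eqI) (simp add: lookup_gcomp)

lemma gcomp_eq_iff: "gcomp dg n v = v \<longleftrightarrow> (\<forall>k. hcomp (n - int (dg k)) (lookup v k) = lookup v k)"
  by (auto simp: poly_mapping_eq_iff fun_eq_iff lookup_gcomp)

lemma gcomp_sum: "gcomp dg n (sum f A) = (\<Sum>x\<in>A. gcomp dg n (f x))"
  by (induction A rule: infinite_finite_induct) (auto simp: gcomp_add)

lemma gcomp_smul:
  fixes c :: "('v::finite, 'k::field) mpoly"
  assumes "hcomp e c = c"
  shows "gcomp dg n (smul c v) = smul c (gcomp dg (n - e) v)"
proof (rule poly_mapping_eqI)
  fix k
  show "lookup (gcomp dg n (smul c v)) k = lookup (smul c (gcomp dg (n - e) v)) k"
    using hcomp_mult[OF assms, of "n - int (dg k)" "lookup v k"]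
    by (simp add: lookup_gcomp lookup_smul mult.commute diff_diff_eq add.commute)
qed

lemma gcomp_in_free_on: "v \<in> free_on B \<Longrightarrow> gcomp dg n v \<in> free_on B"
  by (simp add: free_on_iff lookup_gcomp)

text \<open>Maps of degree 0 commute with graded components. Coefficientwise this is
  \<open>hcomp_mult\<close>, as the entry of \<open>d k\<close> at \<open>l\<close> is homogeneous
  of degree \<open>dg' k - dg l\<close>.\<close>

lemma gcomp_lincomb:
  fixes d :: "nat \<Rightarrow> (nat \<Rightarrow>\<^sub>0 ('v::finite, 'k::field) mpoly)"
  assumes "\<And>k. k \<in> B \<Longrightarrow> gcomp dg (int (dg' k)) (d k) = d k" "v \<in> free_on B"
  shows "gcomp dg n (lincomb d v) = lincomb d (gcomp dg' n v)"
proof (rule poly_mapping_eqI)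
  fix l
  have k: "hcomp (n - int (dg l)) (lookup v k * lookup (d k) l)
       = hcomp (n - int (dg' k)) (lookup v k) * lookup (d k) l" if "k \<in> keys v" for k
  proof -
    have "gcomp dg (int (dg' k)) (d k) = d k" using assms that by (auto simp: free_on_def)
    then show ?thesis
      using hcomp_mult[of "int (dg' k) - int (dg l)" "lookup (d k) l" "n - int (dg l)"]
      by (simp add: gcomp_eq_iff)
  qed
  have sub: "keys (gcomp dg' n v) \<subseteq> keys v" by (auto simp: in_keys_iff lookup_gcomp)
  show "lookup (gcomp dg n (lincomb d v)) l = lookup (lincomb d (gcomp dg' n v)) l"
    by (simp add: lookup_gcomp lookup_lincomb hcomp_sum k lincomb_superset[OF _ sub]
        lookup_sum lookup_smul)
qed

lemma gcomp_decompose: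
  fixes v :: "nat \<Rightarrow>\<^sub>0 ('v::finite, 'k::field) mpoly"
  obtains N where "finite N" "v = (\<Sum>n\<in>N. gcomp dg (int n) v)"
proof
  define N where "N = (\<Union>k\<in>keys v. (\<lambda>m. mdeg m + dg k) ` keys (lookup v k))"
  show fin: "finite N" by (simp add: N_def)
  show "v = (\<Sum>n\<in>N. gcomp dg (int n) v)"
  proof (intro poly_mapping_eqI)
    fix k m
    have "lookup (lookup (\<Sum>n\<in>N. gcomp dg (int n) v) k) m
        = (\<Sum>n\<in>N. if n = mdeg m + dg k then lookup (lookup v k) m else 0)"
      unfolding lookup_sum lookup_gcomp lookup_hcomp
      by (rule sum.cong[OF refl], rule if_cong) auto
    also have "\<dots> = lookup (lookup v k) m"
    proof (cases "mdeg m + dg k \<in> N")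
      case False
      then have "lookup (lookup v k) m = 0"
        unfolding N_def by (metis (no_types, lifting) UN_I image_eqI in_keys_iff lookup_zero)
      then show ?thesis by (simp cong: if_cong)
    qed (use fin in simp)
    finally show "lookup (lookup v k) m = lookup (lookup (\<Sum>n\<in>N. gcomp dg (int n) v) k) m" ..
  qed
qed

section \<open>Existence of graded free resolutions\<close>

definition graded_submodule ::
    "nat set \<Rightarrow> (nat \<Rightarrow> nat) \<Rightarrow> (nat \<Rightarrow>\<^sub>0 ('v, 'k::field) mpoly) set \<Rightarrow> bool" where
  "graded_submodule B dg Z \<longleftrightarrow> Z \<subseteq> free_on B \<and> 0 \<in> Z \<and> (\<forall>v\<in>Z. \<forall>w\<in>Z. v + w \<in> Z) \<and>
     (\<forall>c. \<forall>v\<in>Z. smul c v \<in> Z) \<and> (\<forall>n. \<forall>v\<in>Z. gcomp dg n v \<in> Z)"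

lemma graded_submodule_sum:
  "graded_submodule B dg Z \<Longrightarrow> (\<And>x. x \<in> A \<Longrightarrow> f x \<in> Z) \<Longrightarrow> sum f A \<in> Z"
  by (induction A rule: infinite_finite_induct) (auto simp: graded_submodule_def)

lemma gcomp_eq_iff_mdeg:
  "gcomp dg (int n) v = v \<longleftrightarrow> (\<forall>l. \<forall>m\<in>keys (lookup v l). mdeg m + dg l = n)"
  unfolding gcomp_eq_iff hcomp_eq_iff by (intro iff_allI ball_cong) auto

lemma graded_submodule_kernel:
  fixes d :: "nat \<Rightarrow> (nat \<Rightarrow>\<^sub>0 ('v::finite, 'k::field) mpoly)"
  assumes "\<And>k. k \<in> B' \<Longrightarrow> gcomp dg (int (dg' k)) (d k) = d k"
  shows "graded_submodule B' dg' {v \<in> free_on B'. lincomb d v = 0}"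
  unfolding graded_submodule_def
  by (auto simp: free_on_add lincomb_add lincomb_smul free_on_smul gcomp_in_free_on
      gcomp_lincomb[OF assms, symmetric])

lemma vector_space_smul_const:
  "vector_space (\<lambda>c::'k::field. smul (single 0 c :: ('v, 'k) mpoly))"
  by unfold_locales (auto simp: smul_add single_add smul_add_left smul_smul mult_single)

text \<open>In degree \<open>n\<close> the ambient free module is spanned over the field by finitely
  many products of a monomial and a basis element. A linearly independent spanning set of the degree
  \<open>n\<close> part of \<open>Z\<close> is therefore finite.\<close>

lemma finite_generators_of_degree:
  fixes Z :: "(nat \<Rightarrow>\<^sub>0 ('v::finite, 'k::field) mpoly) set"
  assumes fin: "\<And>j. finite {k \<in> B. dg k = j}" and Z: "graded_submodule B dg Z"
  obtains G where "finite G" "G \<subseteq> Z" "\<And>v. v \<in> G \<Longrightarrow> gcomp dg (int n) v = v"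
    "{v \<in> Z. gcomp dg (int n) v = v} \<subseteq> module.span (\<lambda>c. smul (single 0 c)) G"
proof -
  interpret vs: vector_space "\<lambda>c::'k. smul (single 0 c :: ('v, 'k) mpoly)"
    by (rule vector_space_smul_const)
  let ?Zn = "{v \<in> Z. gcomp dg (int n) v = v}"
  define I :: "(nat \<times> ('v \<Rightarrow>\<^sub>0 nat)) set" where "I = {(k, m). k \<in> B \<and> mdeg m + dg k = n}"
  define T where "T = (\<lambda>(k, m). single k (single m 1 :: ('v, 'k) mpoly)) ` I"
  have "I \<subseteq> (\<Union>j\<le>n. {k \<in> B. dg k = j}) \<times> {m. mdeg m \<le> n}" by (auto simp: I_def)
  then have finI: "finite I"
    by (rule finite_subset) (auto simp: fin finite_mdeg_le)
  obtain G where G: "G \<subseteq> ?Zn" "vs.independent G" "?Zn \<subseteq> vs.span G"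
    by (rule vs.maximal_independent_subset)
  have "?Zn \<subseteq> vs.span T"
  proof
    fix v assume v: "v \<in> ?Zn"
    then have B: "keys v \<subseteq> B" using Z by (auto simp: graded_submodule_def free_on_def)
    have deg: "mdeg m + dg k = n" if "m \<in> keys (lookup v k)" for k m
      using v that by (auto simp: gcomp_eq_iff_mdeg)
    have "v = (\<Sum>k\<in>keys v. \<Sum>m\<in>keys (lookup v k).
        smul (single 0 (lookup (lookup v k) m)) (single k (single m 1)))"
    proof -
      have "single k (lookup v k) = (\<Sum>m\<in>keys (lookup v k).
        smul (single 0 (lookup (lookup v k) m)) (single k (single m 1)))" for k
        by (rule poly_mapping_eqI, subst poly_mapping_expand[of "lookup v k"])
          (auto simp: lookup_sum lookup_smul lookup_single when_def mult_single)
      then have "(\<Sum>k\<in>keys v. single k (lookup v k)) = (\<Sum>k\<in>keys v. \<Sum>m\<in>keys (lookup v k).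
          smul (single 0 (lookup (lookup v k) m)) (single k (single m 1)))"
        by (rule sum.cong[OF refl])
      then show ?thesis by (simp only: poly_mapping_expand[symmetric])
    qed
    also have "\<dots> \<in> vs.span T"
      using B deg by (intro vs.span_sum vs.span_scale vs.span_base) (auto simp: T_def I_def)
    finally show "v \<in> vs.span T" .
  qed
  then have "G \<subseteq> vs.span T" using G by blast
  then have "finite G" using vs.independent_span_bound[OF _ G(2)] finI by (auto simp: T_def)
  then show thesis using that G by auto
qed

text \<open>One step of a resolution: the free module has one basis element for each member of
  finite spanning sets of all graded parts of \<open>Z\<close>. No minimality is sought.\<close>

lemma graded_submodule_image:
  fixes Z :: "(nat \<Rightarrow>\<^sub>0 ('v::finite, 'k::field) mpoly) set"
  assumes fin: "\<And>j. finite {k \<in> B. dg k = j}" and Z: "graded_submodule B dg Z"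
  obtains B' dg' d where "\<And>j. finite {k \<in> B'. dg' k = j}" "\<And>k. k \<in> B' \<Longrightarrow> d k \<in> free_on B"
    "\<And>k. k \<in> B' \<Longrightarrow> gcomp dg (int (dg' k)) (d k) = d k" "lincomb d ` free_on B' = Z"
proof -
  let ?span = "module.span (\<lambda>c. smul (single 0 c :: ('v, 'k) mpoly))"
  interpret vs: vector_space "\<lambda>c::'k. smul (single 0 c :: ('v, 'k) mpoly)"
    by (rule vector_space_smul_const)
  have "\<forall>n. \<exists>G. finite G \<and> G \<subseteq> Z \<and> (\<forall>v\<in>G. gcomp dg (int n) v = v) \<and>
      {v \<in> Z. gcomp dg (int n) v = v} \<subseteq> ?span G"
  proof
    fix n show "\<exists>G. finite G \<and> G \<subseteq> Z \<and> (\<forall>v\<in>G. gcomp dg (int n) v = v) \<and>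
      {v \<in> Z. gcomp dg (int n) v = v} \<subseteq> ?span G"
      by (rule finite_generators_of_degree[OF fin Z]) blast
  qed
  then obtain G where "\<forall>n. finite (G n) \<and> G n \<subseteq> Z \<and> (\<forall>v\<in>G n. gcomp dg (int n) v = v) \<and>
      {v \<in> Z. gcomp dg (int n) v = v} \<subseteq> ?span (G n)"
    by (rule choice[THEN exE])
  then have G: "\<And>n. finite (G n)" "\<And>n. G n \<subseteq> Z"
    "\<And>n v. v \<in> G n \<Longrightarrow> gcomp dg (int n) v = v"
    "\<And>n. {v \<in> Z. gcomp dg (int n) v = v} \<subseteq> ?span (G n)"
    by simp_all
  have "\<exists>e. G n = e ` {..<card (G n)}" for n
    using ex_bij_betw_nat_finite[OF G(1)[of n]] by (auto simp: bij_betw_def atLeast0LessThan)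
  then obtain e where e: "\<And>n. G n = e n ` {..<card (G n)}" by metis
  \<comment> \<open>A basis element codes a pair of degree and index, so its degree is the first
    component.\<close>
  define B' where "B' = prod_encode ` (SIGMA n:UNIV. {..<card (G n)})"
  define dg' where "dg' k = fst (prod_decode k)" for k
  define d where "d k = e (fst (prod_decode k)) (snd (prod_decode k))" for k
  have dG: "d k \<in> G (dg' k)" if k: "k \<in> B'" for k
  proof -
    obtain n i where "k = prod_encode (n, i)" "i < card (G n)" using k by (auto simp: B'_def)
    then show ?thesis using e[of n] by (auto simp: dg'_def d_def)
  qed
  show thesis
  proof
    show "finite {k \<in> B'. dg' k = j}" for j
      by (rule finite_subset[of _ "(\<lambda>i. prod_encode (j, i)) ` {..<card (G j)}"])
        (auto simp: B'_def dg'_def)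
    show "d k \<in> free_on B" if "k \<in> B'" for k
      using dG[OF that] G(2) Z by (auto simp: graded_submodule_def)
    show "gcomp dg (int (dg' k)) (d k) = d k" if "k \<in> B'" for k
      using dG[OF that] G(3) by blast
    show "lincomb d ` free_on B' = Z"
    proof
      show "lincomb d ` free_on B' \<subseteq> Z"
      proof (clarify)
        fix v :: "nat \<Rightarrow>\<^sub>0 ('v, 'k) mpoly" assume v: "v \<in> free_on B'"
        show "lincomb d v \<in> Z" unfolding lincomb_def
        proof (rule graded_submodule_sum[OF Z])
          fix k assume "k \<in> keys v"
          then have "d k \<in> Z" using v dG G(2) by (auto simp: free_on_def)
          then show "smul (lookup v k) (d k) \<in> Z" using Z by (auto simp: graded_submodule_def)
        qed
      qed
      have add: "v + w \<in> lincomb d ` free_on B'"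
        if "v \<in> lincomb d ` free_on B'" "w \<in> lincomb d ` free_on B'" for v w
        using that by (auto simp: lincomb_add[symmetric] free_on_add)
      have scale: "smul c v \<in> lincomb d ` free_on B'" if "v \<in> lincomb d ` free_on B'" for v c
        using that by (auto simp: lincomb_smul[symmetric] free_on_smul)
      have zero: "0 \<in> lincomb d ` free_on B'"
        by (rule image_eqI[of _ _ 0]) simp_all
      have gen: "v \<in> lincomb d ` free_on B'" if v: "v \<in> G n" for v n
      proof -
        obtain i where "i < card (G n)" "v = e n i" using v e by blast
        then have "v = lincomb d (single (prod_encode (n, i)) 1)"
          "single (prod_encode (n, i)) 1 \<in> free_on B'"
          by (auto simp: d_def B'_def free_on_def)
        then show ?thesis by blast
      qed
      have span: "v \<in> lincomb d ` free_on B'" if "v \<in> ?span (G n)" for v n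
        using that by (induction rule: vs.span_induct_alt) (auto intro: zero add scale gen)
      show "Z \<subseteq> lincomb d ` free_on B'"
      proof
        fix v assume v: "v \<in> Z"
        obtain N where N: "finite N" "v = (\<Sum>n\<in>N. gcomp dg (int n) v)"
          by (rule gcomp_decompose)
        have comp: "gcomp dg (int n) v \<in> lincomb d ` free_on B'" for n
          using v Z G(4)[of n] by (intro span[of _ n]) (auto simp: graded_submodule_def)
        have "(\<Sum>n\<in>N. gcomp dg (int n) v) \<in> lincomb d ` free_on B'"
          using N(1) by (induction N rule: finite_induct) (auto intro: zero add comp)
        then show "v \<in> lincomb d ` free_on B'" by (simp only: N(2)[symmetric])
      qed
    qed
  qed
qed

text \<open>The assumptions say that \<open>I\<close> is a homogeneous ideal. Dependent choice
  builds the modules one by one, each covering the kernel left by its predecessor.\<close>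

lemma graded_free_resolution_exists:
  fixes I :: "('v::finite, 'k::field) mpoly set"
  assumes I0: "0 \<in> I" and Iadd: "\<And>f g. f \<in> I \<Longrightarrow> g \<in> I \<Longrightarrow> f + g \<in> I"
    and Imult: "\<And>c f. f \<in> I \<Longrightarrow> c * f \<in> I" and Ihom: "\<And>n f. f \<in> I \<Longrightarrow> hcomp n f \<in> I"
  shows "\<exists>F. graded_free_resolution I F"
proof -
  \<comment> \<open>A state consists of a basis, its degrees, the differential on it, and the
    submodule \<open>Z\<close> that the next differential must cover: a copy of \<open>I\<close> at
    the start, the kernel of \<open>d\<close> afterwards.\<close>
  define P :: "nat \<Rightarrow> nat set \<times> (nat \<Rightarrow> nat) \<times> (nat \<Rightarrow> (nat \<Rightarrow>\<^sub>0 ('v, 'k) mpoly))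
      \<times> (nat \<Rightarrow>\<^sub>0 ('v, 'k) mpoly) set \<Rightarrow> bool" where
    "P n = (\<lambda>(B, dg, d, Z). (\<forall>j. finite {k \<in> B. dg k = j}) \<and> graded_submodule B dg Z \<and>
      (n = 0 \<longrightarrow> B = {0} \<and> dg = (\<lambda>_. 0) \<and> Z = {v \<in> free_on {0}. lookup v 0 \<in> I}))" for n
  define R :: "nat \<Rightarrow> nat set \<times> (nat \<Rightarrow> nat) \<times> (nat \<Rightarrow> (nat \<Rightarrow>\<^sub>0 ('v, 'k) mpoly))
      \<times> (nat \<Rightarrow>\<^sub>0 ('v, 'k) mpoly) set \<Rightarrow> nat set \<times> (nat \<Rightarrow> nat) \<times> (nat \<Rightarrow> (nat \<Rightarrow>\<^sub>0 ('v, 'k) mpoly))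
      \<times> (nat \<Rightarrow>\<^sub>0 ('v, 'k) mpoly) set \<Rightarrow> bool" where
    "R n = (\<lambda>(B, dg, d, Z) (B', dg', d', Z').
      (\<forall>k\<in>B'. d' k \<in> free_on B \<and> gcomp dg (int (dg' k)) (d' k) = d' k) \<and>
      lincomb d' ` free_on B' = Z \<and> Z' = {v \<in> free_on B'. lincomb d' v = 0})" for n
  have "\<exists>f. \<forall>n. P n (f n) \<and> R n (f n) (f (Suc n))"
  proof (rule dependent_nat_choice)
    have "graded_submodule {0} (\<lambda>_. 0) {v \<in> free_on {0}. lookup v 0 \<in> I}"
      unfolding graded_submodule_def
      by (auto simp: I0 Iadd Imult Ihom lookup_add lookup_smul lookup_gcomp free_on_add
          free_on_smul gcomp_in_free_on)
    then have "P 0 ({0}, (\<lambda>_. 0), (\<lambda>_. 0), {v \<in> free_on {0}. lookup v 0 \<in> I})"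
      by (auto simp: P_def)
    then show "\<exists>x. P 0 x" by blast
  next
    fix x n assume "P n x"
    moreover obtain B dg d Z where x: "x = (B, dg, d, Z)" by (cases x) auto
    ultimately have fin: "\<And>j. finite {k \<in> B. dg k = j}" and Z: "graded_submodule B dg Z"
      by (auto simp: P_def)
    obtain B' dg' d' where "\<And>j. finite {k \<in> B'. dg' k = j}" "\<And>k. k \<in> B' \<Longrightarrow> d' k \<in> free_on B"
      "\<And>k. k \<in> B' \<Longrightarrow> gcomp dg (int (dg' k)) (d' k) = d' k" "lincomb d' ` free_on B' = Z"
      by (rule graded_submodule_image[OF fin Z]) (rule that; blast)
    then have "P (Suc n) (B', dg', d', {v \<in> free_on B'. lincomb d' v = 0}) \<and>
        R n x (B', dg', d', {v \<in> free_on B'. lincomb d' v = 0})"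
      by (auto simp: P_def R_def x intro: graded_submodule_kernel)
    then show "\<exists>y. P (Suc n) y \<and> R n x y" by blast
  qed
  then obtain f where f: "\<And>n. P n (f n)" "\<And>n. R n (f n) (f (Suc n))" by blast
  define B where "B n = fst (f n)" for n
  define dg where "dg n = fst (snd (f n))" for n
  define d where "d n = fst (snd (snd (f n)))" for n
  define Z where "Z n = snd (snd (snd (f n)))" for n
  have fn: "f n = (B n, dg n, d n, Z n)" for n by (simp add: B_def dg_def d_def Z_def)
  have fin: "finite {k \<in> B n. dg n k = j}" for n j using f(1)[of n] by (simp add: fn P_def)
  have base: "B 0 = {0}" "dg 0 = (\<lambda>_. 0)" "Z 0 = {v \<in> free_on {0}. lookup v 0 \<in> I}"
    using f(1)[of 0] by (simp_all add: fn P_def)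
  have ZS: "Z (Suc n) = {v \<in> free_on (B (Suc n)). lincomb (d (Suc n)) v = 0}"
    and im: "lincomb (d (Suc n)) ` free_on (B (Suc n)) = Z n" for n
    using f(2)[of n] by (simp_all add: fn R_def)
  have d: "d (Suc n) k \<in> free_on (B n)" "gcomp (dg n) (int (dg (Suc n) k)) (d (Suc n) k) = d (Suc n) k"
    if "k \<in> B (Suc n)" for n k
    using f(2)[of n] that by (simp_all add: fn R_def)
  define F where "F = \<lparr>basis = B, bdeg = dg, diff = d, aug = (\<lambda>_. 1)\<rparr>"
  have aug: "aug_map F v = lookup v 0" if "v \<in> free_on {0}" for v
    using that lincomb_superset[of "{0}" v "\<lambda>k. single 0 (aug F k)"]
    by (simp add: aug_map_conv_lincomb F_def free_on_def lookup_smul)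
  have F0: "basis F 0 = {0}" by (simp add: F_def base)
  have "\<forall>f. \<exists>v\<in>free_on (basis F 0). f - aug_map F v \<in> I"
  proof
    fix f :: "('v, 'k) mpoly"
    have "single 0 f \<in> free_on {0::nat}" by (simp add: free_on_def)
    then show "\<exists>v\<in>free_on (basis F 0). f - aug_map F v \<in> I"
      by (intro bexI[of _ "single 0 f"]) (auto simp: aug I0 F0)
  qed
  moreover have "lincomb (diff F 1) ` free_on (basis F 1) = {v \<in> free_on (basis F 0). aug_map F v \<in> I}"
    using im[of 0] by (auto simp: F_def base aug[unfolded F_def])
  moreover have "lincomb (diff F (Suc i)) ` free_on (basis F (Suc i)) =
        {v \<in> free_on (basis F i). lincomb (diff F i) v = 0}" if "i \<ge> 1" for i
    using im[of i] ZS[of "i - 1"] that by (simp add: F_def)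
  moreover have "homogeneous 0 (1 :: ('v, 'k) mpoly)"
    by (simp add: homogeneous_def)
  ultimately have "graded_free_resolution I F"
    unfolding graded_free_resolution_def
    using d fin by (auto simp: F_def base gcomp_eq_iff_mdeg)
  then show ?thesis ..
qed

section \<open>Koszul complexes\<close>

text \<open>An element of \<open>\<And>V \<otimes> M\<close>, for the vector space \<open>V\<close> on the variables, is encoded by its
  coefficients \<open>z T\<close> on the basis vectors \<open>e\<^sub>T\<close>; signs refer to the enumeration \<open>to_nat\<close>.\<close>

definition ksgn :: "'v::countable \<Rightarrow> 'v set \<Rightarrow> 'r::comm_ring_1" where
  "ksgn v T = (-1) ^ card {u \<in> T. to_nat u < to_nat v}"

text \<open>With \<open>W = UNIV\<close> this is the Koszul differential; smaller \<open>W\<close>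
  give the partial differentials from which the cycle on an antichain is built.\<close>

definition kos :: "'v::finite set \<Rightarrow> ('v set \<Rightarrow> ('v, 'k::field) mpoly) \<Rightarrow> 'v set \<Rightarrow> ('v, 'k) mpoly" where
  "kos W z T = (\<Sum>v\<in>W - T. ksgn v T * var v * z (insert v T))"

lemma ksgn_insert:
  assumes "finite T" "v \<notin> T"
  shows "ksgn w (insert v T) = (if to_nat v < to_nat w then - ksgn w T else ksgn w T)"
proof -
  have "{u \<in> insert v T. to_nat u < to_nat w} =
      (if to_nat v < to_nat w then insert v {u \<in> T. to_nat u < to_nat w} else {u \<in> T. to_nat u < to_nat w})"
    by auto
  then show ?thesis using assms by (auto simp: ksgn_def)
qed

lemma ksgn_square [simp]: "ksgn v T * ksgn v T = 1"
  by (simp add: ksgn_def flip: power_add)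

lemma ksgn_square_left [simp]: "ksgn v T * (ksgn v T * x) = x"
  by (simp flip: mult.assoc)

text \<open>By injectivity of \<open>to_nat\<close>, exactly one of the two signs changes when the
  other variable is inserted.\<close>

lemma ksgn_swap:
  assumes "finite T" "v \<noteq> w" "v \<notin> T" "w \<notin> T"
  shows "ksgn v T * ksgn w (insert v T) = - (ksgn w T * ksgn v (insert w T))"
    "ksgn w (insert v T) * ksgn v (insert w T) = - (ksgn v T * ksgn w T)"
proof -
  have "to_nat v < to_nat w \<or> to_nat w < to_nat v"
    using assms(2) by (metis inj_eq inj_to_nat linorder_less_linear)
  then show "ksgn v T * ksgn w (insert v T) = - (ksgn w T * ksgn v (insert w T))"
    "ksgn w (insert v T) * ksgn v (insert w T) = - (ksgn v T * ksgn w T)"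
    using assms by (auto simp: ksgn_insert)
qed

lemma ksgn_conv_single: "(ksgn v T :: ('w, 'k::field) mpoly) = single 0 (ksgn v T)"
proof -
  have "(-1) ^ n = (single 0 ((-1) ^ n) :: ('w, 'k) mpoly)" for n
    by (cases "even n") (auto simp: single_uminus)
  then show ?thesis by (simp add: ksgn_def)
qed

lemma hcomp_ksgn_var: "hcomp 1 (ksgn u T * var v :: ('v::finite, 'k::field) mpoly) = ksgn u T * var v"
  using hcomp_eq_mult[OF hcomp_var[of v], of 0 "ksgn u T"] hcomp_sign by (auto simp: ksgn_def)

lemma lookup_ksgn_var:
  fixes f :: "('v::finite, 'k::field) mpoly"
  shows "lookup (ksgn u T * var v * f) m =
    ksgn u T * (if lookup m v \<noteq> 0 then lookup f (m - single v (Suc 0)) else 0)"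
proof -
  have "(\<exists>m'. m = single v (Suc 0) + m') \<longleftrightarrow> lookup m v \<noteq> 0"
  proof
    assume "lookup m v \<noteq> 0"
    then have "m = single v (Suc 0) + (m - single v (Suc 0))"
      by (intro poly_mapping_eqI) (auto simp: lookup_add lookup_minus lookup_single when_def)
    then show "\<exists>m'. m = single v (Suc 0) + m'" by blast
  qed (auto simp: lookup_add)
  then have "lookup (var v * f) m = (if lookup m v \<noteq> 0 then lookup f (m - single v (Suc 0)) else 0)"
    by (simp add: var_def lookup_single_times)
  moreover have "lookup (ksgn u T * g) m = ksgn u T * lookup g m" for g :: "('v, 'k) mpoly"
    using lookup_single_times[of 0 "ksgn u T" g m] by (simp add: ksgn_conv_single[where 'w = 'v])
  ultimately show ?thesis by (simp add: mult.assoc)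
qed

text \<open>Exchanging the summations would only show that twice the sum vanishes, which is too weak
  in characteristic 2. Induction over subsets cancels the terms in pairs instead.\<close>

lemma sum_antisymmetric:
  fixes g :: "'a \<Rightarrow> 'a \<Rightarrow> 'b::ab_group_add"
  assumes "finite A" "\<And>v w. v \<in> A \<Longrightarrow> w \<in> A \<Longrightarrow> v \<noteq> w \<Longrightarrow> g v w = - g w v"
  shows "(\<Sum>v\<in>A. \<Sum>w\<in>A - {v}. g v w) = 0"
proof -
  define h where "h v w = (if v = w then 0 else g v w)" for v w
  have h0: "h v v = 0" for v by (simp add: h_def)
  have h: "h v w = - h w v" if "v \<in> A" "w \<in> A" for v w
    using assms(2)[OF that] by (cases "v = w") (simp_all add: h_def)
  have "(\<Sum>v\<in>B. \<Sum>w\<in>B. h v w) = 0" if "B \<subseteq> A" for B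
    using finite_subset[OF that \<open>finite A\<close>] that
  proof (induction B rule: finite_induct)
    case (insert a B)
    have "(\<Sum>v\<in>B. h v a) = (\<Sum>v\<in>B. - h a v)" using insert.prems h by (intro sum.cong) auto
    then show ?case using insert by (simp add: sum.distrib sum_negf h0)
  qed simp
  moreover have "(\<Sum>w\<in>A. h v w) = (\<Sum>w\<in>A - {v}. g v w)" if "v \<in> A" for v
  proof -
    have "(\<Sum>w\<in>A. h v w) = (\<Sum>w\<in>A - {v}. h v w)"
      using that assms(1) by (simp add: sum.remove[of A v] h0)
    also have "\<dots> = (\<Sum>w\<in>A - {v}. g v w)" by (intro sum.cong) (auto simp: h_def)
    finally show ?thesis .
  qed
  ultimately show ?thesis by (metis (mono_tags, lifting) order_refl sum.cong)
qed

lemma ksgn_swap_times: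
  fixes z :: "'v::finite set \<Rightarrow> ('v, 'k::field) mpoly"
  assumes "v \<noteq> w" "v \<notin> T" "w \<notin> T"
  shows "(ksgn v T * ksgn w (insert v T)) * (var v * var w * z (insert v (insert w T))) =
    - ((ksgn w T * ksgn v (insert w T)) * (var w * var v * z (insert w (insert v T))))"
proof -
  have "var v * var w * z (insert v (insert w T)) = var w * var v * z (insert w (insert v T))"
    by (simp add: insert_commute mult.commute)
  then show ?thesis
    by (simp only: ksgn_swap(1)[OF finite assms] mult_minus_left)
qed

lemma kos_kos: "kos W (kos W z) T = 0"
proof -
  have "kos W (kos W z) T = (\<Sum>v\<in>W - T. \<Sum>w\<in>(W - T) - {v}.
      (ksgn v T * ksgn w (insert v T)) * (var v * var w * z (insert v (insert w T))))"
    unfolding kos_def sum_distrib_left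
    by (intro sum.cong) (auto simp: algebra_simps insert_commute)
  also have "\<dots> = 0"
    by (rule sum_antisymmetric, simp, rule ksgn_swap_times) auto
  finally show ?thesis .
qed

text \<open>Disjointness excludes pairs with \<open>v = w\<close>, so each term matches, up to sign,
  the term with the two contractions exchanged.\<close>

lemma kos_anticommute:
  assumes "W \<inter> W' = {}"
  shows "kos W (kos W' z) T = - kos W' (kos W z) T"
proof -
  have "kos W (kos W' z) T = (\<Sum>v\<in>W - T. \<Sum>w\<in>W' - T.
      (ksgn v T * ksgn w (insert v T)) * (var v * var w * z (insert v (insert w T))))"
    unfolding kos_def sum_distrib_left using assms
    by (intro sum.cong) (auto simp: algebra_simps insert_commute)
  also have "\<dots> = (\<Sum>v\<in>W - T. \<Sum>w\<in>W' - T.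
      - ((ksgn w T * ksgn v (insert w T)) * (var w * var v * z (insert w (insert v T)))))"
    using assms by (intro sum.cong refl ksgn_swap_times) auto
  also have "\<dots> = - (\<Sum>w\<in>W' - T. \<Sum>v\<in>W - T.
      (ksgn w T * ksgn v (insert w T)) * (var w * var v * z (insert w (insert v T))))"
    by (subst sum.swap) (simp add: sum_negf)
  also have "(\<Sum>w\<in>W' - T. \<Sum>v\<in>W - T.
      (ksgn w T * ksgn v (insert w T)) * (var w * var v * z (insert w (insert v T)))) = kos W' (kos W z) T"
    unfolding kos_def sum_distrib_left using assms
    by (intro sum.cong) (auto simp: algebra_simps insert_commute)
  finally show ?thesis .
qed

lemma lookup_kos:
  "lookup (kos W z T) m =
    (\<Sum>v\<in>W - T. ksgn v T * (if lookup m v \<noteq> 0 then lookup (z (insert v T)) (m - single v (Suc 0)) else 0))"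
  by (simp add: kos_def lookup_sum lookup_ksgn_var)

text \<open>The Koszul complex is a direct sum over multidegrees \<open>\<alpha>\<close>; for \<open>\<alpha> \<noteq> 0\<close> wedging with
  \<open>e\<^sub>v\<close> and dividing by \<open>x\<^sub>v\<close>, for a fixed variable \<open>v\<close> occurring in \<open>\<alpha>\<close>, is a contracting
  homotopy of the summand.\<close>

definition mdegree :: "'v set \<Rightarrow> ('v \<Rightarrow>\<^sub>0 nat) \<Rightarrow> ('v \<Rightarrow>\<^sub>0 nat)" where
  "mdegree T m = m + (\<Sum>v\<in>T. single v (Suc 0))"

definition pivot :: "'v set \<Rightarrow> ('v \<Rightarrow>\<^sub>0 nat) \<Rightarrow> 'v" where
  "pivot T m = (SOME v. v \<in> keys (mdegree T m))"

definition khom :: "('v::finite set \<Rightarrow> ('v, 'k::field) mpoly) \<Rightarrow> 'v set \<Rightarrow> ('v, 'k) mpoly" where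
  "khom z T = Abs_poly_mapping (\<lambda>m. let v = pivot T m in if v \<in> T
     then ksgn v (T - {v}) * lookup (z (T - {v})) (m + single v (Suc 0)) else 0)"

text \<open>The support is finite: each of its monomials arises from a monomial of some
  \<open>z (T - {v})\<close> on division by the variable \<open>v\<close>.\<close>

lemma lookup_khom:
  "lookup (khom z T) m = (let v = pivot T m in if v \<in> T
     then ksgn v (T - {v}) * lookup (z (T - {v})) (m + single v (Suc 0)) else 0)"
proof -
  let ?f = "\<lambda>m. let v = pivot T m in if v \<in> T
     then ksgn v (T - {v}) * lookup (z (T - {v})) (m + single v (Suc 0)) else 0"
  have "{m. ?f m \<noteq> 0} \<subseteq> (\<Union>v\<in>T. (\<lambda>m. m - single v (Suc 0)) ` keys (z (T - {v})))"
  proof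
    fix m assume m: "m \<in> {m. ?f m \<noteq> 0}"
    let ?v = "pivot T m"
    have "?v \<in> T" "m + single ?v (Suc 0) \<in> keys (z (T - {?v}))"
      using m by (auto simp: Let_def in_keys_iff split: if_splits)
    moreover have "m = (m + single ?v (Suc 0)) - single ?v (Suc 0)" by simp
    ultimately show "m \<in> (\<Union>v\<in>T. (\<lambda>m. m - single v (Suc 0)) ` keys (z (T - {v})))" by blast
  qed
  then have "finite {m. ?f m \<noteq> 0}" by (rule finite_subset) simp
  then show ?thesis unfolding khom_def by (subst lookup_Abs_poly_mapping) auto
qed

lemma keys_mdegree: "v \<in> keys (mdegree T m) \<longleftrightarrow> v \<in> T \<or> lookup m v \<noteq> 0" for v :: "'v::finite"
  by (auto simp: mdegree_def in_keys_iff lookup_add lookup_sum lookup_single when_def)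

text \<open>The Koszul differential preserves the multidegree. As \<open>pivot\<close> depends only
  on the multidegree, both composites in the homotopy identity use the same variable.\<close>

lemma mdegree_insert:
  fixes v :: "'v::finite"
  assumes "v \<notin> T" "lookup m v \<noteq> 0"
  shows "mdegree (insert v T) (m - single v (Suc 0)) = mdegree T m"
  using assms
  by (intro poly_mapping_eqI) (auto simp: mdegree_def lookup_add lookup_minus lookup_single when_def)

text \<open>The homotopy identity, read off at one coefficient. The excluded pair
  \<open>T = {}\<close>, \<open>m = 0\<close> is multidegree 0, where there is no pivot and the
  homology is the field.\<close>

lemma kos_khom:
  fixes z :: "'v::finite set \<Rightarrow> ('v, 'k::field) mpoly"
  assumes "T \<noteq> {} \<or> m \<noteq> 0"
  shows "lookup (kos UNIV (khom z) T) m + lookup (khom (kos UNIV z) T) m = lookup (z T) m"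
proof -
  define v where "v = pivot T m"
  define U where "U = T - {v}"
  have "\<exists>v. v \<in> keys (mdegree T m)"
    unfolding keys_mdegree using assms by (auto simp: poly_mapping_eq_iff fun_eq_iff)
  then have v: "v \<in> T \<or> lookup m v \<noteq> 0"
    unfolding v_def pivot_def keys_mdegree[symmetric] by (rule someI_ex)
  have piv: "pivot (insert w T) (m - single w (Suc 0)) = v" if "w \<notin> T" "lookup m w \<noteq> 0" for w
    using mdegree_insert[OF that] by (simp add: v_def pivot_def)
  have shift: "m - single w (Suc 0) + single v (Suc 0) = m + single v (Suc 0) - single w (Suc 0)" if "lookup m w \<noteq> 0" for w
    using that by (intro poly_mapping_eqI) (auto simp: lookup_add lookup_minus lookup_single when_def)
  have 1: "lookup (kos UNIV (khom z) T) m = (\<Sum>w\<in>-T. ksgn w T * (if lookup m w \<noteq> 0 \<and> v \<in> insert w T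
      then ksgn v (insert w T - {v}) * lookup (z (insert w T - {v})) (m - single w (Suc 0) + single v (Suc 0)) else 0))"
    unfolding lookup_kos Compl_eq_Diff_UNIV[symmetric]
    by (intro sum.cong) (auto simp: lookup_khom piv Let_def)
  have 2: "lookup (khom (kos UNIV z) T) m = (if v \<in> T then ksgn v U * lookup (kos UNIV z U) (m + single v (Suc 0)) else 0)"
    by (simp add: lookup_khom Let_def v_def U_def)
  show ?thesis
  proof (cases "v \<in> T")
    \<comment> \<open>Here the second composite vanishes, and in the first only the summand
      \<open>w = v\<close> survives.\<close>
    case False
    then have m: "lookup m v \<noteq> 0" using v by simp
    have "lookup (kos UNIV (khom z) T) m = (\<Sum>w\<in>-T. if w = v then ksgn v T * (ksgn v T * lookup (z T) m) else 0)"
      unfolding 1 using False m by (intro sum.cong refl) (auto simp: shift simp del: ksgn_square_left)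
    then show ?thesis using False by (simp add: 2)
  next
    \<comment> \<open>The summand for \<open>v\<close> of the inner Koszul differential yields
      \<open>z T\<close>; the remaining summands of the two composites cancel by
      \<open>ksgn_swap\<close>.\<close>
    case True
    then have T: "T = insert v U" "v \<notin> U" by (auto simp: U_def)
    have U: "- U = insert v (- T)" using True by (auto simp: U_def)
    have "lookup (kos UNIV z U) (m + single v (Suc 0)) = ksgn v U * lookup (z T) m +
       (\<Sum>w\<in>-T. ksgn w U * (if lookup m w \<noteq> 0 then lookup (z (insert w U)) (m + single v (Suc 0) - single w (Suc 0)) else 0))"
      unfolding lookup_kos Compl_eq_Diff_UNIV[symmetric] U using True
      by (subst sum.insert) (auto simp: T(1)[symmetric] lookup_add lookup_single when_def intro!: sum.cong)
    moreover have "lookup (kos UNIV (khom z) T) m = - (ksgn v U *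
       (\<Sum>w\<in>-T. ksgn w U * (if lookup m w \<noteq> 0 then lookup (z (insert w U)) (m + single v (Suc 0) - single w (Suc 0)) else 0)))"
      unfolding 1 sum_distrib_left sum_negf[symmetric]
    proof (intro sum.cong refl)
      fix w assume "w \<in> - T"
      then have w: "w \<notin> U" "w \<noteq> v" "insert w T - {v} = insert w U" using T by auto
      have "ksgn w T * ksgn v (insert w U) = - (ksgn v U * ksgn w U :: 'k)"
        unfolding T(1) using ksgn_swap(2)[of U v w] w T(2) by auto
      then have "ksgn w T * (ksgn v (insert w U) * x) = - (ksgn v U * (ksgn w U * x))" for x :: 'k
        by (metis mult.assoc mult_minus_left)
      then show "ksgn w T * (if lookup m w \<noteq> 0 \<and> v \<in> insert w T
          then ksgn v (insert w T - {v}) * lookup (z (insert w T - {v})) (m - single w (Suc 0) + single v (Suc 0)) else 0)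
        = - (ksgn v U * (ksgn w U * (if lookup m w \<noteq> 0
          then lookup (z (insert w U)) (m + single v (Suc 0) - single w (Suc 0)) else 0)))"
        using True by (simp add: w shift)
    qed
    ultimately show ?thesis using True by (simp add: 2 distrib_left)
  qed
qed

lemma khom_0: "khom (\<lambda>T. 0) T = 0"
  by (rule poly_mapping_eqI) (simp add: lookup_khom Let_def)

lemma kos_exact:
  fixes z :: "'v::finite set \<Rightarrow> ('v, 'k::field) mpoly"
  assumes "\<And>T. kos UNIV z T = 0" "lookup (z {}) 0 = 0"
  shows "kos UNIV (khom z) T = z T"
proof (rule poly_mapping_eqI)
  fix m
  have "khom (kos UNIV z) T = 0" using assms(1) khom_0 by (metis ext)
  then show "lookup (kos UNIV (khom z) T) m = lookup (z T) m"
  proof (cases "T = {} \<and> m = 0")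
    case True
    then show ?thesis using assms(2) by (simp add: lookup_kos)
  qed (use kos_khom[of T m z] in auto)
qed

lemma khom_homogeneous:
  assumes "\<And>T. hcomp (n - int (card T)) (z T) = z T"
  shows "hcomp (n - int (card T)) (khom z T) = khom z T"
  unfolding hcomp_eq_iff
proof
  fix m assume "m \<in> keys (khom z T)"
  then obtain v where v: "v \<in> T" "m + single v (Suc 0) \<in> keys (z (T - {v}))"
    by (auto simp: in_keys_iff lookup_khom Let_def split: if_splits)
  then have "int (mdeg (m + single v (Suc 0))) = n - int (card (T - {v}))"
    using assms hcomp_eq_iff by blast
  moreover have "card T = Suc (card (T - {v}))" using v by (intro card.remove) simp_all
  ultimately show "int (mdeg m) = n - int (card T)"
    by (simp add: mdeg_add)
qed

lemma khom_eq_0: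
  assumes "\<And>T. card T \<noteq> b \<Longrightarrow> z T = 0" "card T \<noteq> Suc b"
  shows "khom z T = 0"
proof (rule poly_mapping_eqI)
  fix m
  have "z (T - {v}) = 0" if "v \<in> T" for v
    using assms that by (metis card.remove finite_code)
  then show "lookup (khom z T) m = lookup 0 m"
    by (simp add: lookup_khom Let_def)
qed

section \<open>Koszul complexes with coefficients in a graded free module\<close>

definition kosF :: "('v::finite set \<Rightarrow> (nat \<Rightarrow>\<^sub>0 ('v, 'k::field) mpoly)) \<Rightarrow> 'v set \<Rightarrow> (nat \<Rightarrow>\<^sub>0 ('v, 'k) mpoly)" where
  "kosF z T = (\<Sum>v\<in>-T. smul (ksgn v T * var v) (z (insert v T)))"

lemma lookup_kosF: "lookup (kosF z T) k = kos UNIV (\<lambda>T. lookup (z T) k) T"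
  by (simp add: kosF_def kos_def lookup_sum lookup_smul Compl_eq_Diff_UNIV)

lemma kosF_kosF: "kosF (kosF z) = 0"
proof (rule ext, rule poly_mapping_eqI)
  fix T k
  show "lookup (kosF (kosF z) T) k = lookup (0 T) k"
    by (simp add: lookup_kosF kos_kos)
qed

lemma kosF_diff: "kosF (z - w) = kosF z - kosF w"
  by (rule ext) (simp add: kosF_def smul_diff sum_subtractf)

lemma kosF_0 [simp]: "kosF 0 = 0"
  by (rule ext) (simp add: kosF_def)

text \<open>Koszul boundaries have coefficients in the ideal of the variables. This makes the Koszul
  terms at the ends of zigzags disappear over the field.\<close>

lemma lookup_kosF_0: "lookup (lookup (kosF z T) k) 0 = 0"
  by (simp add: lookup_kosF lookup_kos)

text \<open>The part of total degree \<open>n\<close> and exterior degree \<open>b\<close>, where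
  each variable in \<open>T\<close> counts with degree 1; hence the shift by
  \<open>card T\<close>.\<close>

definition kcomplex ::
    "nat set \<Rightarrow> (nat \<Rightarrow> nat) \<Rightarrow> int \<Rightarrow> nat \<Rightarrow> ('v::finite set \<Rightarrow> (nat \<Rightarrow>\<^sub>0 ('v, 'k::field) mpoly)) set" where
  "kcomplex B dg n b = {z. (\<forall>T. z T \<in> free_on B \<and> gcomp dg (n - int (card T)) (z T) = z T) \<and>
     (\<forall>T. card T \<noteq> b \<longrightarrow> z T = 0)}"

lemma kcomplex_0: "0 \<in> kcomplex B dg n b"
  by (simp add: kcomplex_def)

lemma kcomplex_diff: "z \<in> kcomplex B dg n b \<Longrightarrow> w \<in> kcomplex B dg n b \<Longrightarrow> z - w \<in> kcomplex B dg n b"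
  by (auto simp: kcomplex_def free_on_diff gcomp_diff)

lemma kosF_kcomplex:
  assumes z: "z \<in> kcomplex B dg n (Suc b)"
  shows "kosF z \<in> kcomplex B dg n b"
proof -
  have "gcomp dg (n - int (card T)) (kosF z T) = kosF z T" for T
    unfolding kosF_def gcomp_sum
  proof (intro sum.cong refl)
    fix v assume "v \<in> - T"
    then have eq: "n - int (card T) - 1 = n - int (card (insert v T))" by simp
    then show "gcomp dg (n - int (card T)) (smul (ksgn v T * var v) (z (insert v T)))
      = smul (ksgn v T * var v) (z (insert v T))"
      unfolding gcomp_smul[OF hcomp_ksgn_var] eq using z by (simp add: kcomplex_def del: card_insert_disjoint)
  qed
  moreover have "kosF z T = 0" if "card T \<noteq> b" for T
    unfolding kosF_def
  proof (intro sum.neutral ballI)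
    fix v assume "v \<in> - T"
    then have "z (insert v T) = 0" using z that by (simp add: kcomplex_def)
    then show "smul (ksgn v T * var v) (z (insert v T)) = 0" by simp
  qed
  moreover have "kosF z T \<in> free_on B" for T
    unfolding kosF_def using z by (intro free_on_sum free_on_smul) (auto simp: kcomplex_def)
  ultimately show ?thesis by (auto simp: kcomplex_def)
qed

text \<open>Each coordinate is contracted by \<open>khom\<close>, and \<open>K\<close> collects the
  finitely many nonzero ones. For \<open>b = 0\<close> the condition on constant terms excludes the
  homology of the Koszul complex.\<close>

lemma kosF_exact:
  fixes z :: "'v::finite set \<Rightarrow> (nat \<Rightarrow>\<^sub>0 ('v, 'k::field) mpoly)"
  assumes z: "z \<in> kcomplex B dg n b" and cycle: "kosF z = 0"
    and const: "b = 0 \<Longrightarrow> (\<And>k. lookup (lookup (z {}) k) 0 = 0)"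
  shows "\<exists>y\<in>kcomplex B dg n (Suc b). kosF y = z"
proof -
  define zk where "zk k T = lookup (z T) k" for k T
  define K where "K = (\<Union>T. keys (z T))"
  define y where "y T = (\<Sum>k\<in>K. single k (khom (zk k) T))" for T
  have "finite K" by (simp add: K_def)
  have "zk k = (\<lambda>T. 0)" if "k \<notin> K" for k
    using that by (auto simp: zk_def K_def in_keys_iff fun_eq_iff)
  then have y: "lookup (y T) k = khom (zk k) T" for T k
    using \<open>finite K\<close> khom_0 by (auto simp: y_def lookup_sum lookup_single when_def)
  have zk0: "zk k T = 0" if "card T \<noteq> b" for k T
    using z that by (simp add: kcomplex_def zk_def)
  have zkB: "zk k = (\<lambda>T. 0)" if "k \<notin> B" for k
    using z that by (auto simp: zk_def kcomplex_def free_on_iff fun_eq_iff)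
  have hom: "hcomp (n - int (dg k) - int (card T)) (zk k T) = zk k T" for k T
    using z by (simp add: kcomplex_def gcomp_eq_iff zk_def algebra_simps)
  have "y \<in> kcomplex B dg n (Suc b)"
    unfolding kcomplex_def
  proof (intro CollectI conjI allI impI)
    fix T
    show "y T \<in> free_on B" by (simp add: free_on_iff y zkB khom_0)
    show "gcomp dg (n - int (card T)) (y T) = y T"
      using khom_homogeneous[OF hom] by (simp add: gcomp_eq_iff y algebra_simps)
    show "y T = 0" if "card T \<noteq> Suc b"
      using khom_eq_0[OF zk0 that] by (intro poly_mapping_eqI) (simp add: y)
  qed
  moreover have "kosF y = z"
  proof (rule ext, rule poly_mapping_eqI)
    fix T k
    have "kos UNIV (zk k) T = 0" for T
      using cycle lookup_kosF[of z T k] by (simp add: zk_def[abs_def])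
    moreover have "lookup (zk k {}) 0 = 0"
      using const zk0[of "{}" k] by (cases "b = 0") (auto simp: zk_def)
    ultimately have "kos UNIV (khom (zk k)) T = zk k T" by (rule kos_exact)
    then show "lookup (kosF y T) k = lookup (z T) k"
      by (simp add: lookup_kosF y zk_def)
  qed
  ultimately show ?thesis by blast
qed

section \<open>Computing Tor by a double complex\<close>

text \<open>Here \<open>a\<close> is the homological degree in \<open>F\<close> and \<open>b\<close>
  the exterior degree. Exactness of \<open>d\<close> for \<open>a \<ge> 1\<close> and of
  \<open>e\<close> for \<open>b \<ge> 1\<close> leaves homology only at the two edges. The squares
  commute rather than anticommute, which suffices for chasing elements.\<close>

locale double_complex =
  fixes C :: "nat \<Rightarrow> nat \<Rightarrow> 'x::ab_group_add set" and d :: "nat \<Rightarrow> 'x \<Rightarrow> 'x" and e :: "'x \<Rightarrow> 'x"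
  assumes C_0: "0 \<in> C a b"
    and C_diff: "z \<in> C a b \<Longrightarrow> w \<in> C a b \<Longrightarrow> z - w \<in> C a b"
    and e_mem: "z \<in> C a (Suc b) \<Longrightarrow> e z \<in> C a b"
    and d_mem: "z \<in> C (Suc a) b \<Longrightarrow> d (Suc a) z \<in> C a b"
    and e_diff: "e (z - w) = e z - e w"
    and d_diff: "d a (z - w) = d a z - d a w"
    and commute: "e (d a z) = d a (e z)"
    and e_e: "e (e z) = 0"
    and d_d: "z \<in> C (Suc (Suc a)) b \<Longrightarrow> d (Suc a) (d (Suc (Suc a)) z) = 0"
    and d_exact: "z \<in> C (Suc a) b \<Longrightarrow> d (Suc a) z = 0 \<Longrightarrow> \<exists>y\<in>C (Suc (Suc a)) b. d (Suc (Suc a)) y = z"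
    and e_exact: "z \<in> C a (Suc b) \<Longrightarrow> e z = 0 \<Longrightarrow> \<exists>y\<in>C a (Suc (Suc b)). e y = z"
begin

text \<open>A staircase from \<open>z\<close> in \<open>C a b\<close> to \<open>x\<close> in
  \<open>C (a + b) 0\<close>: each step applies \<open>e\<close> and lifts along \<open>d\<close>.
  It is a relation because the lifts are not unique.\<close>

fun zigzag :: "nat \<Rightarrow> nat \<Rightarrow> 'x \<Rightarrow> 'x \<Rightarrow> bool" where
  "zigzag a 0 z x \<longleftrightarrow> z = x \<and> z \<in> C a 0"
| "zigzag a (Suc b) z x \<longleftrightarrow> z \<in> C a (Suc b) \<and>
     (\<exists>z'\<in>C (Suc a) b. e z = d (Suc a) z' \<and> zigzag (Suc a) b z' x)"

lemma d_zero: "d a 0 = 0"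
  using d_diff[of a 0 0] by simp

text \<open>Exactness of \<open>d\<close> gives each lift, and \<open>e_e\<close> restores the
  hypothesis for the lifted element.\<close>

lemma zigzag_exists_right:
  assumes "z \<in> C (Suc a) b" "d (Suc a) (e z) = 0"
  shows "\<exists>x. zigzag (Suc a) b z x"
  using assms
proof (induction b arbitrary: a z)
  case (Suc b)
  obtain z' where z': "z' \<in> C (Suc (Suc a)) b" "d (Suc (Suc a)) z' = e z"
    using d_exact[OF e_mem] Suc.prems by blast
  then have "d (Suc (Suc a)) (e z') = 0" by (simp add: e_e flip: commute)
  then obtain x where "zigzag (Suc (Suc a)) b z' x" using Suc.IH[OF z'(1)] by blast
  then have "zigzag (Suc a) (Suc b) z x" using z' Suc.prems(1) by (auto intro!: bexI[of _ z'])
  then show ?case ..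
qed auto

lemma zigzag_exists_from_0:
  assumes "z \<in> C 0 (Suc b)" "z' \<in> C 1 b" "e z = d 1 z'"
  shows "\<exists>x. zigzag 0 (Suc b) z x"
proof -
  have "d 1 (e z') = 0" using assms(3) e_e commute by metis
  then show ?thesis using zigzag_exists_right[of z' 0 b] assms by auto
qed

lemma zigzag_end: "zigzag a b z x \<Longrightarrow> x \<in> C (a + b) 0"
  by (induction a b z x rule: zigzag.induct) auto

text \<open>The witness \<open>t\<close> is the last but one element of the staircase.\<close>

lemma zigzag_d_end: "zigzag a (Suc b) z x \<Longrightarrow> \<exists>t\<in>C (a + b) 1. d (Suc (a + b)) x = e t"
proof (induction b arbitrary: a z)
  case 0
  then have "z \<in> C a 1" "e z = d (Suc a) x" by auto
  then show ?case by (intro bexI[of _ z]) simp_all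
next
  case (Suc b)
  then obtain z' where "zigzag (Suc a) (Suc b) z' x" by auto
  from Suc.IH[OF this] show ?case by simp
qed

text \<open>Boundaries propagate against the direction of the staircase: subtracting
  \<open>d (Suc a) t\<close> leaves an \<open>e\<close>-cycle, to which exactness of
  \<open>e\<close> applies.\<close>

lemma zigzag_boundary_left:
  assumes "zigzag a b z x" "x = d (Suc (a + b)) y + e t" "y \<in> C (Suc (a + b)) 0" "t \<in> C (a + b) 1"
  shows "\<exists>y\<in>C (Suc a) b. \<exists>t\<in>C a (Suc b). z = d (Suc a) y + e t"
  using assms
proof (induction b arbitrary: a z)
  case 0
  then show ?case by auto
next
  case (Suc b)
  then obtain z' where z: "z \<in> C a (Suc b)" and z': "z' \<in> C (Suc a) b" "e z = d (Suc a) z'"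
    "zigzag (Suc a) b z' x" by auto
  from Suc.IH[OF z'(3)] Suc.prems obtain y t where yt: "y \<in> C (Suc (Suc a)) b" "t \<in> C (Suc a) (Suc b)"
    "z' = d (Suc (Suc a)) y + e t" by auto
  have "e (z - d (Suc a) t) = d (Suc a) (z' - e t)"
    by (simp add: e_diff d_diff commute z'(2))
  also have "\<dots> = 0" using yt by (simp add: d_d)
  finally obtain s where "s \<in> C a (Suc (Suc b))" "e s = z - d (Suc a) t"
    using e_exact C_diff z d_mem yt(2) by blast
  then show ?case using yt(2) by (intro bexI[of _ t] bexI[of _ s]) auto
qed

text \<open>Boundaries also propagate along the staircase: \<open>z' - e y\<close> is a
  \<open>d\<close>-cycle, so exactness of \<open>d\<close> applies.\<close>

lemma zigzag_boundary_right:
  assumes "zigzag a b z x" "z = d (Suc a) y + e t" "y \<in> C (Suc a) b" "t \<in> C a (Suc b)"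
  shows "\<exists>y\<in>C (Suc (a + b)) 0. \<exists>t\<in>C (a + b) 1. x = d (Suc (a + b)) y + e t"
  using assms
proof (induction b arbitrary: a z y t)
  case 0
  then show ?case by auto
next
  case (Suc b)
  then obtain z' where z': "z' \<in> C (Suc a) b" "e z = d (Suc a) z'" "zigzag (Suc a) b z' x" by auto
  have "e (d (Suc a) y) = e (z - e t)" using Suc.prems(2) by simp
  then have "d (Suc a) (z' - e y) = 0"
    by (simp add: d_diff z'(2)[symmetric] commute[symmetric] e_diff e_e)
  then obtain s where "s \<in> C (Suc (Suc a)) b" "d (Suc (Suc a)) s = z' - e y"
    using d_exact C_diff z'(1) e_mem Suc.prems(3) by blast
  then have "z' = d (Suc (Suc a)) s + e y" by simp
  from Suc.IH[OF z'(3) this] show ?case using Suc.prems(3) \<open>s \<in> C (Suc (Suc a)) b\<close> by simp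
qed

text \<open>The staircase is built backwards from \<open>x\<close>: the image under \<open>d\<close>
  of its current top is an \<open>e\<close>-cycle and lifts along \<open>e\<close>.\<close>

lemma zigzag_exists_left:
  assumes "x \<in> C (Suc i) 0" "t \<in> C i 1" "d (Suc i) x = e t" "b \<le> i"
  shows "\<exists>z. zigzag (i - b) (Suc b) z x"
  using \<open>b \<le> i\<close>
proof (induction b)
  case 0
  then show ?case using assms by (auto intro!: exI[of _ t] bexI[of _ x])
next
  case (Suc b)
  then obtain z where z: "zigzag (i - b) (Suc b) z x" by auto
  obtain a where a: "i - b = Suc a" "i - Suc b = a" using Suc.prems by (metis Suc_diff_Suc Suc_le_lessD)
  then obtain z' where z': "z \<in> C (Suc a) (Suc b)" "z' \<in> C (Suc (Suc a)) b" "e z = d (Suc (Suc a)) z'"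
    using z by auto
  have "e (d (Suc a) z) = 0" using z' by (simp add: commute d_d)
  then obtain s where "s \<in> C a (Suc (Suc b))" "e s = d (Suc a) z"
    using e_exact[OF d_mem[OF z'(1)]] by blast
  then have "zigzag a (Suc (Suc b)) s x" using z z'(1) a by (subst zigzag.simps) auto
  then show ?case using a by auto
qed

end

section \<open>Reduction modulo the variables\<close>

definition cst :: "(nat \<Rightarrow>\<^sub>0 ('v, 'k::field) mpoly) \<Rightarrow> (nat \<Rightarrow>\<^sub>0 'k)" where
  "cst v = Poly_Mapping.map (\<lambda>f. lookup f 0) v"

definition emb :: "(nat \<Rightarrow>\<^sub>0 'k::field) \<Rightarrow> (nat \<Rightarrow>\<^sub>0 ('v, 'k) mpoly)" where
  "emb w = Poly_Mapping.map (single 0) w"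

lemma lookup_cst: "lookup (cst v) k = lookup (lookup v k) 0"
  by (simp add: cst_def Poly_Mapping.map.rep_eq when_def)

lemma lookup_emb: "lookup (emb w) k = single 0 (lookup w k)"
  by (simp add: emb_def Poly_Mapping.map.rep_eq when_def)

lemma cst_emb [simp]: "cst (emb w) = w"
  by (rule poly_mapping_eqI) (simp add: lookup_cst lookup_emb)

lemma cst_add: "cst (v + w) = cst v + cst w"
  by (rule poly_mapping_eqI) (simp add: lookup_cst lookup_add)

lemma cst_0 [simp]: "cst 0 = 0"
  by (rule poly_mapping_eqI) (simp add: lookup_cst)

lemma cst_lincomb: "cst (lincomb d v) = lincomb (\<lambda>k. cst (d k)) (cst v)"
proof (rule poly_mapping_eqI)
  fix l
  have sub: "keys (cst v) \<subseteq> keys v" by (auto simp: in_keys_iff lookup_cst)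
  show "lookup (cst (lincomb d v)) l = lookup (lincomb (\<lambda>k. cst (d k)) (cst v)) l"
    unfolding lincomb_superset[OF finite_keys sub]
    by (simp add: lookup_cst lookup_lincomb lookup_sum lookup_times_0 lookup_smul)
qed

lemma diff_K_cst: "diff_K F i (cst v) = cst (lincomb (diff F i) v)"
  unfolding cst_lincomb unfolding diff_K_def cst_def ..

lemma diff_K_conv: "diff_K F i w = cst (lincomb (diff F i) (emb w))"
  using diff_K_cst[of F i "emb w"] by simp

lemma emb_comp_K:
  fixes F :: "('v, 'k::field) graded_free_complex"
  assumes "w \<in> comp_K F i j"
  shows "(emb w :: nat \<Rightarrow>\<^sub>0 ('v, 'k) mpoly) \<in> free_on (basis F i)"
    "gcomp (bdeg F i) (int j) (emb w :: nat \<Rightarrow>\<^sub>0 ('v, 'k) mpoly) = emb w"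
  using assms
  by (auto simp: comp_K_def free_on_iff lookup_emb gcomp_eq_iff hcomp_eq_iff in_keys_iff
      lookup_single when_def split: if_splits)

text \<open>A constant has degree 0, so in an element of degree \<open>j\<close> it can only occur
  at a basis element of degree \<open>j\<close>.\<close>

lemma cst_comp_K:
  assumes "v \<in> free_on (basis F i)" "gcomp (bdeg F i) (int j) v = v"
  shows "cst v \<in> comp_K F i j"
proof -
  have "lookup (lookup v k) 0 = 0" if "bdeg F i k \<noteq> j" for k
  proof (rule ccontr)
    assume "lookup (lookup v k) 0 \<noteq> 0"
    then have "mdeg (0 :: 'a \<Rightarrow>\<^sub>0 nat) + bdeg F i k = j"
      using assms(2) unfolding gcomp_eq_iff_mdeg by (metis in_keys_iff)
    then show False using that by simp
  qed
  then show ?thesis using assms(1) by (auto simp: comp_K_def free_on_iff lookup_cst)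
qed

definition at0 :: "(nat \<Rightarrow>\<^sub>0 ('v, 'k::field) mpoly) \<Rightarrow> 'v set \<Rightarrow> (nat \<Rightarrow>\<^sub>0 ('v, 'k) mpoly)" where
  "at0 v T = (if T = {} then v else 0)"

lemma at0_kcomplex:
  "v \<in> free_on B \<Longrightarrow> gcomp dg n v = v \<Longrightarrow> at0 v \<in> kcomplex B dg n 0"
  by (auto simp: kcomplex_def at0_def)

lemma kosF_kcomplex_0:
  assumes "z \<in> kcomplex B dg n 0"
  shows "kosF z = 0"
proof (rule ext)
  fix T
  have "z (insert v T) = 0" for v using assms by (simp add: kcomplex_def card_gt_0_iff)
  then show "kosF z T = 0 T" by (simp add: kosF_def)
qed

definition mapF :: "(nat \<Rightarrow> (nat \<Rightarrow>\<^sub>0 ('v, 'k::field) mpoly)) \<Rightarrow>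
    ('v set \<Rightarrow> (nat \<Rightarrow>\<^sub>0 ('v, 'k) mpoly)) \<Rightarrow> 'v set \<Rightarrow> (nat \<Rightarrow>\<^sub>0 ('v, 'k) mpoly)" where
  "mapF d z T = lincomb d (z T)"

text \<open>Preimages \<open>u T\<close> are first chosen without regard to degree. Their graded
  components are still preimages, since \<open>z\<close> is homogeneous and \<open>d\<close> has
  degree 0.\<close>

lemma mapF_lift:
  fixes d :: "nat \<Rightarrow> (nat \<Rightarrow>\<^sub>0 ('v::finite, 'k::field) mpoly)"
  assumes d: "\<And>k. k \<in> B' \<Longrightarrow> gcomp dg (int (dg' k)) (d k) = d k"
    and z: "z \<in> kcomplex B dg n b" and im: "\<And>T. z T \<in> lincomb d ` free_on B'"
  shows "\<exists>y\<in>kcomplex B' dg' n b. mapF d y = z"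
proof -
  have "\<forall>T. \<exists>u. u \<in> free_on B' \<and> lincomb d u = z T"
  proof
    fix T
    from im[of T] show "\<exists>u. u \<in> free_on B' \<and> lincomb d u = z T" by auto
  qed
  then obtain u where u: "\<And>T. u T \<in> free_on B'" "\<And>T. lincomb d (u T) = z T" by metis
  define y where "y T = (if card T = b then gcomp dg' (n - int (card T)) (u T) else 0)" for T
  have "y \<in> kcomplex B' dg' n b"
    by (auto simp: kcomplex_def y_def u gcomp_in_free_on)
  moreover have "mapF d y = z"
  proof (rule ext)
    fix T
    show "mapF d y T = z T"
    proof (cases "card T = b")
      case True
      moreover have "gcomp dg (n - int (card T)) (z T) = z T" using z by (simp add: kcomplex_def)
      ultimately show ?thesis
        by (simp add: mapF_def y_def gcomp_lincomb[OF d u(1), symmetric] u(2))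
    next
      case False
      then show ?thesis using z by (simp add: mapF_def y_def kcomplex_def)
    qed
  qed
  ultimately show ?thesis by blast
qed

lemma mapF_kcomplex:
  fixes d :: "nat \<Rightarrow> (nat \<Rightarrow>\<^sub>0 ('v::finite, 'k::field) mpoly)"
  assumes d: "\<And>k. k \<in> B' \<Longrightarrow> gcomp dg (int (dg' k)) (d k) = d k" "\<And>k. k \<in> B' \<Longrightarrow> d k \<in> free_on B"
    and z: "z \<in> kcomplex B' dg' n b"
  shows "mapF d z \<in> kcomplex B dg n b"
proof -
  have "z T \<in> free_on B'" for T using z by (simp add: kcomplex_def)
  moreover from this have "lincomb d (z T) \<in> free_on B" for T
    by (rule lincomb_in_free_on) (rule d(2))
  ultimately show ?thesis
    using z by (auto simp: kcomplex_def mapF_def gcomp_lincomb[OF d(1)])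
qed

lemma kosF_mapF: "kosF (mapF d z) = mapF d (kosF z)"
  by (rule ext) (simp add: kosF_def mapF_def lincomb_sum lincomb_smul)

lemma mapF_diff: "mapF d (z - w) = mapF d z - mapF d w"
  by (rule ext) (simp add: mapF_def lincomb_diff)

section \<open>Koszul homology and Tor for an arbitrary resolution\<close>

locale resolution =
  fixes I :: "('v::finite, 'k::field) mpoly set" and F :: "('v, 'k) graded_free_complex"
  assumes res: "graded_free_resolution I F"
    and I_0: "0 \<in> I" and I_add: "\<And>f g. f \<in> I \<Longrightarrow> g \<in> I \<Longrightarrow> f + g \<in> I"
    and I_mult: "\<And>c f. f \<in> I \<Longrightarrow> c * f \<in> I" and I_hcomp: "\<And>n f. f \<in> I \<Longrightarrow> hcomp n f \<in> I"
begin

lemma diff_free_on: "k \<in> basis F (Suc i) \<Longrightarrow> diff F (Suc i) k \<in> free_on (basis F i)"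
  and diff_degree: "k \<in> basis F (Suc i) \<Longrightarrow>
    gcomp (bdeg F i) (int (bdeg F (Suc i) k)) (diff F (Suc i) k) = diff F (Suc i) k"
  using res by (auto simp: graded_free_resolution_def gcomp_eq_iff_mdeg)

lemma image_diff: "lincomb (diff F (Suc (Suc i))) ` free_on (basis F (Suc (Suc i))) =
    {v \<in> free_on (basis F (Suc i)). lincomb (diff F (Suc i)) v = 0}"
  and image_diff_1: "lincomb (diff F 1) ` free_on (basis F 1) = {v \<in> free_on (basis F 0). aug_map F v \<in> I}"
  using res by (auto simp: graded_free_resolution_def)

lemma diff_diff: "v \<in> free_on (basis F (Suc (Suc i))) \<Longrightarrow>
    lincomb (diff F (Suc i)) (lincomb (diff F (Suc (Suc i))) v) = 0"
  using image_diff[of i] by blast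

lemma finite_basis: "finite {k \<in> basis F i. bdeg F i k = j}"
  using res by (auto simp: graded_free_resolution_def)

lemma I_diff: "f \<in> I \<Longrightarrow> g \<in> I \<Longrightarrow> f - g \<in> I"
  using I_add[of f "(-1) * g"] I_mult[of g "-1"] by simp

lemma I_sum: "(\<And>x. x \<in> A \<Longrightarrow> f x \<in> I) \<Longrightarrow> sum f A \<in> I"
  by (induction A rule: infinite_finite_induct) (auto simp: I_0 I_add)

lemma kos_in_I: "(\<And>T. z T \<in> I) \<Longrightarrow> kos W z T \<in> I"
  by (auto simp: kos_def intro!: I_sum I_mult)

lemma double_complex:
  "double_complex (\<lambda>a. kcomplex (basis F a) (bdeg F a) n) (\<lambda>a. mapF (diff F a)) kosF"
proof
  fix a b and z w :: "'v set \<Rightarrow> (nat \<Rightarrow>\<^sub>0 ('v, 'k) mpoly)"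
  let ?C = "\<lambda>a. kcomplex (basis F a) (bdeg F a) n"
  show "z \<in> ?C (Suc a) b \<Longrightarrow> mapF (diff F (Suc a)) z \<in> ?C a b"
    by (rule mapF_kcomplex[OF diff_degree diff_free_on])
  show "mapF (diff F (Suc a)) (mapF (diff F (Suc (Suc a))) z) = 0" if "z \<in> ?C (Suc (Suc a)) b"
    using that by (auto simp: mapF_def kcomplex_def fun_eq_iff intro!: diff_diff)
  show "\<exists>y\<in>?C (Suc (Suc a)) b. mapF (diff F (Suc (Suc a))) y = z"
    if z: "z \<in> ?C (Suc a) b" "mapF (diff F (Suc a)) z = 0"
  proof (rule mapF_lift[OF diff_degree z(1)])
    show "z T \<in> lincomb (diff F (Suc (Suc a))) ` free_on (basis F (Suc (Suc a)))" for T
      unfolding image_diff using z(1) fun_cong[OF z(2), of T] by (auto simp: kcomplex_def mapF_def)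
  qed
  show "\<exists>y\<in>?C a (Suc (Suc b)). kosF y = z" if "z \<in> ?C a (Suc b)" "kosF z = 0"
    by (rule kosF_exact[OF that]) simp
qed (simp_all add: kcomplex_0 kcomplex_diff kosF_kcomplex kosF_diff mapF_diff kosF_mapF kosF_kosF)

lemma diff_1_lift:
  assumes "z \<in> kcomplex (basis F 0) (bdeg F 0) n b" "\<And>T. aug_map F (z T) \<in> I"
  shows "\<exists>y\<in>kcomplex (basis F 1) (bdeg F 1) n b. mapF (diff F 1) y = z"
proof (rule mapF_lift)
  show "z T \<in> lincomb (diff F 1) ` free_on (basis F 1)" for T
    unfolding image_diff_1 using assms by (auto simp: kcomplex_def)
qed (use diff_degree[of _ 0] assms in auto)

lemma aug_map_gcomp:
  assumes "v \<in> free_on (basis F 0)"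
  shows "aug_map F (gcomp (bdeg F 0) n v) = hcomp n (aug_map F v)"
proof -
  have "gcomp (\<lambda>_. 0) (int (bdeg F 0 k)) (single 0 (aug F k)) = single 0 (aug F k)"
    if "k \<in> basis F 0" for k
    unfolding gcomp_eq_iff_mdeg
    using res that by (auto simp: graded_free_resolution_def homogeneous_def lookup_single when_def)
  from gcomp_lincomb[where d = "\<lambda>k. single 0 (aug F k)" and dg = "\<lambda>_. 0" and n = n, OF this assms, symmetric]
  show ?thesis
    by (simp add: aug_map_conv_lincomb lookup_gcomp)
qed

text \<open>As for \<open>mapF_lift\<close>, but modulo \<open>I\<close>: passing to graded
  components replaces the error by its own component, which stays in \<open>I\<close> by
  \<open>I_hcomp\<close>.\<close>

lemma aug_lift:
  assumes "\<And>T. hcomp (n - int (card T)) (z T) = z T" "\<And>T. card T \<noteq> b \<Longrightarrow> z T = 0"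
  shows "\<exists>y\<in>kcomplex (basis F 0) (bdeg F 0) n b. \<forall>T. z T - aug_map F (y T) \<in> I"
proof -
  have "\<forall>T. \<exists>v. v \<in> free_on (basis F 0) \<and> z T - aug_map F v \<in> I"
    using res unfolding graded_free_resolution_def by blast
  then obtain u where u: "\<And>T. u T \<in> free_on (basis F 0)" "\<And>T. z T - aug_map F (u T) \<in> I" by metis
  define y where "y T = (if card T = b then gcomp (bdeg F 0) (n - int (card T)) (u T) else 0)" for T
  have "y \<in> kcomplex (basis F 0) (bdeg F 0) n b"
    by (auto simp: kcomplex_def y_def u gcomp_in_free_on)
  moreover have "z T - aug_map F (y T) \<in> I" for T
  proof (cases "card T = b")
    case True
    have "z T - aug_map F (y T) = hcomp (n - int (card T)) (z T - aug_map F (u T))"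
      using True assms(1)[of T] by (simp add: y_def aug_map_gcomp u hcomp_diff)
    then show ?thesis using u(2) by (simp add: I_hcomp)
  next
    case False
    then show ?thesis by (simp add: y_def assms(2) I_0)
  qed
  ultimately show ?thesis by blast
qed

lemma boundaries_subset_cycles: "boundaries_K F i j \<subseteq> cycles_K F i j"
proof
  fix x assume "x \<in> boundaries_K F i j"
  then obtain y where y: "y \<in> comp_K F (Suc i) j" "x = cst (lincomb (diff F (Suc i)) (emb y))"
    by (auto simp: boundaries_K_def diff_K_conv)
  note e = emb_comp_K[OF y(1)]
  have "x \<in> comp_K F i j"
    unfolding y(2)
    by (rule cst_comp_K) (auto simp: lincomb_in_free_on[OF e(1) diff_free_on] gcomp_lincomb[OF diff_degree e(1)] e(2))
  moreover have "diff_K F i x = 0" if i: "i \<noteq> 0"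
  proof -
    obtain i' where "i = Suc i'" using i by (cases i) auto
    then show ?thesis using diff_diff[of "emb y" i'] e(1) by (simp add: y(2) diff_K_cst)
  qed
  ultimately show "x \<in> cycles_K F i j" by (auto simp: cycles_K_def)
qed

text \<open>A zigzag joins a cycle in homological degree \<open>i\<close> to an element of exterior
  degree \<open>i\<close>. That element is zero because there are fewer than \<open>i\<close>
  variables, so the cycle is a boundary.\<close>

lemma tor_dim_eq_0:
  assumes "card (UNIV :: 'v set) < i"
  shows "tor_dim F i j = 0"
proof -
  interpret dc: double_complex "\<lambda>a. kcomplex (basis F a) (bdeg F a) (int j)" "\<lambda>a. mapF (diff F a)" kosF
    by (rule double_complex)
  have "cycles_K F i j \<subseteq> boundaries_K F i j"
  proof
    fix x assume x: "x \<in> cycles_K F i j"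
    obtain i' where i: "i = Suc i'" using assms by (cases i) auto
    let ?X = "at0 (emb x) :: 'v set \<Rightarrow> (nat \<Rightarrow>\<^sub>0 ('v, 'k) mpoly)"
    have X: "?X \<in> kcomplex (basis F i) (bdeg F i) (int j) 0"
      using x emb_comp_K[of x F i j] by (intro at0_kcomplex) (auto simp: cycles_K_def)
    have dX: "mapF (diff F i) ?X \<in> kcomplex (basis F i') (bdeg F i') (int j) 0"
      using X i dc.d_mem by blast
    \<comment> \<open>As \<open>x\<close> is a cycle over the field, the image of its lift has no
      constant terms and is therefore a Koszul boundary; this starts the zigzag.\<close>
    have "lookup (cst (mapF (diff F i) ?X {})) k = 0" for k
      using x i by (simp add: mapF_def at0_def cycles_K_def diff_K_conv)
    then obtain t where t: "t \<in> kcomplex (basis F i') (bdeg F i') (int j) 1" "kosF t = mapF (diff F i) ?X"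
      using kosF_exact[OF dX kosF_kcomplex_0[OF dX]] by (auto simp: lookup_cst)
    obtain z where z: "dc.zigzag 0 i z ?X"
      using dc.zigzag_exists_left[of ?X i' t i'] X t i by auto
    then have "z \<in> kcomplex (basis F 0) (bdeg F 0) (int j) i" by (simp add: i)
    moreover have "card T \<noteq> i" for T :: "'v set"
      using assms card_mono[of UNIV T] by simp
    ultimately have "z = 0" by (auto simp: kcomplex_def)
    then have "z = mapF (diff F (Suc 0)) 0 + kosF 0" by (simp add: dc.d_zero)
    from dc.zigzag_boundary_right[OF z this dc.C_0 dc.C_0]
    obtain y s where y: "y \<in> kcomplex (basis F (Suc i)) (bdeg F (Suc i)) (int j) 0"
      and "?X = mapF (diff F (Suc i)) y + kosF s" by auto
    then have "emb x = lincomb (diff F (Suc i)) (y {}) + kosF s {}"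
      by (auto simp: fun_eq_iff mapF_def at0_def dest: spec[of _ "{}"])
    moreover have "cst (kosF s {}) = 0"
      by (rule poly_mapping_eqI) (simp add: lookup_cst lookup_kosF_0)
    ultimately have "x = diff_K F (Suc i) (cst (y {}))"
      by (metis cst_add cst_emb diff_K_cst add.right_neutral)
    moreover have "cst (y {}) \<in> comp_K F (Suc i) j"
      using y by (intro cst_comp_K) (auto simp: kcomplex_def dest: spec[of _ "{}"])
    ultimately show "x \<in> boundaries_K F i j" by (auto simp: boundaries_K_def)
  qed
  then have "cycles_K F i j = boundaries_K F i j" using boundaries_subset_cycles by blast
  then show ?thesis by (simp add: tor_dim_def)
qed

lemma boundaries_add:
  assumes "x \<in> boundaries_K F i j" "y \<in> boundaries_K F i j"
  shows "x + y \<in> boundaries_K F i j"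
proof -
  obtain a b where "a \<in> comp_K F (Suc i) j" "x = diff_K F (Suc i) a"
    "b \<in> comp_K F (Suc i) j" "y = diff_K F (Suc i) b"
    using assms by (auto simp: boundaries_K_def)
  then show ?thesis
    unfolding boundaries_K_def diff_K_def comp_K_def
    by (intro image_eqI[of _ _ "a + b"]) (auto simp: lincomb_add free_on_add)
qed

lemma boundaries_smul:
  assumes "x \<in> boundaries_K F i j"
  shows "smul c x \<in> boundaries_K F i j"
proof -
  obtain a where "a \<in> comp_K F (Suc i) j" "x = diff_K F (Suc i) a"
    using assms by (auto simp: boundaries_K_def)
  then show ?thesis
    unfolding boundaries_K_def diff_K_def comp_K_def
    by (intro image_eqI[of _ _ "smul c a"]) (auto simp: lincomb_smul free_on_smul)
qed

lemma boundaries_0: "0 \<in> boundaries_K F i j"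
  unfolding boundaries_K_def diff_K_def comp_K_def by (rule image_eqI[of _ _ 0]) simp_all

text \<open>The difference in \<open>tor_dim\<close> truncates, so a strict inequality of dimensions
  is needed: a basis of the boundaries stays independent in the cycles when \<open>x\<close> is
  added. Finiteness comes from \<open>finite_basis\<close>.\<close>

lemma tor_dim_nonzero:
  assumes x: "x \<in> cycles_K F i j" "x \<notin> boundaries_K F i j"
  shows "tor_dim F i j \<noteq> 0"
proof -
  interpret vs: vector_space "smul :: 'k \<Rightarrow> (nat \<Rightarrow>\<^sub>0 'k) \<Rightarrow> (nat \<Rightarrow>\<^sub>0 'k)"
    by (rule vector_space_smul)
  define T where "T = (\<lambda>k. single k (1::'k)) ` {k \<in> basis F i. bdeg F i k = j}"
  have span: "v \<in> vs.span T" if v: "v \<in> comp_K F i j" for v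
  proof -
    have "(\<Sum>k\<in>keys v. smul (lookup v k) (single k 1)) \<in> vs.span T"
      using v by (intro vs.span_sum vs.span_scale vs.span_base) (auto simp: T_def comp_K_def free_on_def)
    moreover have "smul (lookup v k) (single k 1) = single k (lookup v k)" for k
      by (rule poly_mapping_eqI) (simp add: lookup_smul lookup_single when_def)
    ultimately show ?thesis by (simp only: poly_mapping_expand[symmetric])
  qed
  have cyc: "cycles_K F i j \<subseteq> vs.span T" using span by (auto simp: cycles_K_def)
  have finT: "finite T" by (simp add: T_def finite_basis)
  obtain A where A: "A \<subseteq> boundaries_K F i j" "vs.independent A" "boundaries_K F i j \<subseteq> vs.span A"
    "card A = vs.dim (boundaries_K F i j)"
    by (rule vs.basis_exists)
  have "vs.subspace (boundaries_K F i j)"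
    by (auto simp: vs.subspace_def boundaries_0 boundaries_add boundaries_smul)
  then have "x \<notin> vs.span A" using vs.span_minimal[OF A(1)] x(2) by blast
  then have ind: "vs.independent (insert x A)" by (rule vs.independent_insertI) (rule A(2))
  have "insert x A \<subseteq> cycles_K F i j"
    using A(1) x(1) boundaries_subset_cycles by blast
  then obtain D where D: "insert x A \<subseteq> D" "D \<subseteq> cycles_K F i j" "vs.independent D" "cycles_K F i j \<subseteq> vs.span D"
    using ind by (rule vs.maximal_independent_subset_extend)
  have "finite D" using vs.independent_span_bound[OF finT D(3)] D(2) cyc by blast
  then have "card (insert x A) \<le> card D" using D(1) by (rule card_mono)
  moreover have "card (insert x A) = Suc (card A)"
    using finite_subset[OF D(1) \<open>finite D\<close>] A(1) x(2) by (auto simp: card_insert_if)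
  moreover have "card D = vs.dim (cycles_K F i j)"
    using D by (intro vs.basis_card_eq_dim)
  ultimately show ?thesis using A(4) by (simp add: tor_dim_def)
qed

text \<open>A primitive of \<open>w\<close> is lifted to \<open>F\<close> and moved along a zigzag
  to a cycle over the field. Were that a boundary, moving back would make \<open>w\<close> the
  Koszul boundary of elements of \<open>I\<close>, which degrees forbid.\<close>

lemma tor_dim_linear_strand:
  fixes w :: "'v set \<Rightarrow> ('v, 'k) mpoly"
  assumes cycle: "\<And>T. kos UNIV w T = 0" and w_I: "\<And>T. w T \<in> I"
    and w_0: "\<And>T. card T \<noteq> i \<Longrightarrow> w T = 0" and w_deg: "\<And>T. hcomp (int d) (w T) = w T"
    and I_deg: "\<And>f n. f \<in> I \<Longrightarrow> n < int d \<Longrightarrow> hcomp n f = 0"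
    and "d \<ge> 1" and nonzero: "w T0 \<noteq> 0"
  shows "tor_dim F (Suc i) (i + d) \<noteq> 0"
proof -
  let ?n = "int (i + d)"
  let ?C = "\<lambda>a. kcomplex (basis F a) (bdeg F a) ?n"
  interpret dc: double_complex ?C "\<lambda>a. mapF (diff F a)" kosF
    by (rule double_complex)
  \<comment> \<open>The primitive has coefficients of degree \<open>d - 1\<close>. Because
    \<open>d \<ge> 1\<close>, the coefficient \<open>w {}\<close> has no constant term, as
    \<open>kos_exact\<close> requires.\<close>
  define z where "z = khom w"
  have "lookup (hcomp (int d) (w {})) 0 = 0" using \<open>d \<ge> 1\<close> by (simp add: lookup_hcomp)
  then have kz: "kos UNIV z T = w T" for T
    unfolding z_def using w_deg by (intro kos_exact cycle) simp
  have "hcomp (?n - int (card T)) (w T) = w T" for T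
    using w_deg[of T] w_0[of T] by (cases "card T = i") auto
  then have z_deg: "hcomp (?n - int (card T)) (z T) = z T" for T
    unfolding z_def by (rule khom_homogeneous)
  have z_0: "z T = 0" if "card T \<noteq> Suc i" for T
    unfolding z_def using w_0 that by (rule khom_eq_0)
  obtain z0 where z0: "z0 \<in> ?C 0 (Suc i)" "\<And>T. z T - aug_map F (z0 T) \<in> I"
    using aug_lift[OF z_deg z_0] by blast
  have aug_kosF: "aug_map F (kosF y T) = kos UNIV (\<lambda>T. aug_map F (y T)) T" for y T
    by (simp add: kosF_def kos_def aug_map_sum aug_map_smul Compl_eq_Diff_UNIV)
  have kos_diff: "kos UNIV (\<lambda>T. f T - g T) T = kos UNIV f T - kos UNIV g T"
    for f g :: "'v set \<Rightarrow> ('v, 'k) mpoly" and T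
    by (simp add: kos_def right_diff_distrib sum_subtractf)
  \<comment> \<open>Modulo \<open>I\<close>, the Koszul boundary of \<open>z0\<close> is that of
    \<open>z\<close>, namely \<open>w\<close>, which itself lies in \<open>I\<close>. This provides
    the first lift of the zigzag.\<close>
  have "aug_map F (kosF z0 T) = w T - kos UNIV (\<lambda>T. z T - aug_map F (z0 T)) T" for T
    by (simp add: kos_diff kz aug_kosF)
  then have "aug_map F (kosF z0 T) \<in> I" for T
    using I_diff[OF w_I kos_in_I] z0(2) by simp
  then obtain z1 where z1: "z1 \<in> ?C 1 i" "mapF (diff F 1) z1 = kosF z0"
    using diff_1_lift[OF kosF_kcomplex[OF z0(1)]] by blast
  obtain X where X: "dc.zigzag 0 (Suc i) z0 X"
    using dc.zigzag_exists_from_0[OF z0(1) z1(1) z1(2)[symmetric]] by blast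
  have XC: "X \<in> ?C (Suc i) 0" using dc.zigzag_end[OF X] by simp
  obtain t where t: "mapF (diff F (Suc i)) X = kosF t" using dc.zigzag_d_end[OF X] by auto
  have cst_kosF: "cst (kosF t {}) = 0" for t :: "'v set \<Rightarrow> (nat \<Rightarrow>\<^sub>0 ('v, 'k) mpoly)"
    by (rule poly_mapping_eqI) (simp add: lookup_cst lookup_kosF_0)
  define x where "x = cst (X {})"
  have "x \<in> comp_K F (Suc i) (i + d)"
    unfolding x_def using XC by (intro cst_comp_K) (auto simp: kcomplex_def dest: spec[of _ "{}"])
  moreover have "diff_K F (Suc i) x = 0"
    using fun_cong[OF t, of "{}"] cst_kosF[of t] by (simp add: x_def diff_K_cst mapF_def)
  ultimately have "x \<in> cycles_K F (Suc i) (i + d)" by (simp add: cycles_K_def)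
  moreover have "x \<notin> boundaries_K F (Suc i) (i + d)"
  proof
    assume "x \<in> boundaries_K F (Suc i) (i + d)"
    then obtain y where y: "y \<in> comp_K F (Suc (Suc i)) (i + d)" "x = diff_K F (Suc (Suc i)) y"
      by (auto simp: boundaries_K_def)
    let ?Y = "at0 (emb y) :: 'v set \<Rightarrow> (nat \<Rightarrow>\<^sub>0 ('v, 'k) mpoly)"
    have Y: "?Y \<in> ?C (Suc (Suc i)) 0" using emb_comp_K[OF y(1)] by (intro at0_kcomplex)
    let ?D = "X - mapF (diff F (Suc (Suc i))) ?Y"
    have D: "?D \<in> ?C (Suc i) 0" by (intro dc.C_diff XC dc.d_mem Y)
    have "cst (X {}) = cst (mapF (diff F (Suc (Suc i))) ?Y {})"
      using y(2) by (simp add: x_def diff_K_conv mapF_def at0_def)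
    moreover have "cst (?D {}) = cst (X {}) - cst (mapF (diff F (Suc (Suc i))) ?Y {})"
      by (rule poly_mapping_eqI) (simp add: lookup_cst lookup_minus)
    ultimately have "lookup (cst (?D {})) k = 0" for k by simp
    then obtain s where s: "s \<in> ?C (Suc i) 1" "kosF s = ?D"
      using kosF_exact[OF D kosF_kcomplex_0[OF D]] by (auto simp: lookup_cst)
    then have "X = mapF (diff F (Suc (0 + Suc i))) ?Y + kosF s" by simp
    note * = dc.zigzag_boundary_left[OF X this]
    have "\<exists>u\<in>?C (Suc 0) (Suc i). \<exists>v\<in>?C 0 (Suc (Suc i)). z0 = mapF (diff F (Suc 0)) u + kosF v"
    proof (rule *)
      show "?Y \<in> ?C (Suc (0 + Suc i)) 0" "s \<in> ?C (0 + Suc i) 1"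
        unfolding add_0 by (rule Y s(1))+
    qed
    then obtain u v where u: "u \<in> ?C 1 (Suc i)" and uv: "z0 = mapF (diff F 1) u + kosF v"
      by auto
    \<comment> \<open>Subtracting a Koszul boundary turns \<open>z\<close> into a primitive of
      \<open>w\<close> whose coefficients lie in \<open>I\<close>.\<close>
    define g where "g T = z T - aug_map F (kosF v T)" for T
    have g: "g T \<in> I" for T
    proof -
      have "u T \<in> free_on (basis F 1)" using u by (simp add: kcomplex_def)
      then have "aug_map F (mapF (diff F 1) u T) \<in> I" using image_diff_1 by (auto simp: mapF_def)
      then have "(z T - aug_map F (z0 T)) + aug_map F (mapF (diff F 1) u T) \<in> I"
        using z0(2) by (rule I_add[rotated])
      then show ?thesis by (simp add: g_def uv aug_map_add)
    qed
    have wg: "w T = kos UNIV g T" for T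
    proof -
      have "kos UNIV g T = w T - aug_map F (kosF (kosF v) T)"
        unfolding g_def[abs_def] by (simp add: kos_diff kz aug_kosF[of "kosF v"])
      then show ?thesis by (simp add: kosF_kosF)
    qed
    \<comment> \<open>Only the components of \<open>g\<close> of degree \<open>d - 1\<close> can
      contribute in degree \<open>d\<close>, and \<open>I\<close> has none.\<close>
    have "w T0 = hcomp (int d) (kos UNIV g T0)" using w_deg[of T0] wg by simp
    also have "\<dots> = (\<Sum>v\<in>UNIV - T0. ksgn v T0 * var v * hcomp (int d - 1) (g (insert v T0)))"
      unfolding kos_def hcomp_sum
      by (intro sum.cong refl) (metis hcomp_mult[OF hcomp_ksgn_var] mult.commute)
    also have "\<dots> = 0" using I_deg[OF g] by simp
    finally show False using nonzero by simp
  qed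
  ultimately show ?thesis by (rule tor_dim_nonzero)
qed

end

text \<open>The chosen resolution in \<open>betti\<close> is a genuine one by the existence lemma,
  so the results on arbitrary \<open>F\<close> apply. Vanishing beyond the number of variables gives
  the finiteness behind \<open>Max_ge\<close>.\<close>

lemma le_lin:
  fixes I :: "('v::finite, 'k::field) mpoly set"
  assumes I: "0 \<in> I" "\<And>f g. f \<in> I \<Longrightarrow> g \<in> I \<Longrightarrow> f + g \<in> I"
      "\<And>c f. f \<in> I \<Longrightarrow> c * f \<in> I" "\<And>n f. f \<in> I \<Longrightarrow> hcomp n f \<in> I"
    and I_deg: "\<And>f n. f \<in> I \<Longrightarrow> n < int (min_gen_degree I) \<Longrightarrow> hcomp n f = 0"
    and w: "\<And>T. kos UNIV w T = 0" "\<And>T. w T \<in> I" "\<And>T. card T \<noteq> i \<Longrightarrow> w T = 0"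
      "\<And>T. hcomp (int (min_gen_degree I)) (w T) = w T" "w T0 \<noteq> 0"
    and d: "min_gen_degree I \<ge> 1"
  shows "Suc i \<le> lin I"
proof -
  define F where "F = (SOME F. graded_free_resolution I F)"
  have "graded_free_resolution I F"
    unfolding F_def using graded_free_resolution_exists[OF I] by (rule someI_ex)
  then interpret resolution I F
    using I by unfold_locales
  have betti: "betti I i j = tor_dim F i j" for i j by (simp add: betti_def F_def)
  have "betti I i' j = 0" if "card (UNIV :: 'v set) < i'" for i' j
    unfolding betti using that by (rule tor_dim_eq_0)
  then have "{i. betti I i (i + min_gen_degree I - 1) \<noteq> 0} \<subseteq> {..card (UNIV :: 'v set)}"
    by (auto simp: not_less[symmetric])
  then have "finite {i. betti I i (i + min_gen_degree I - 1) \<noteq> 0}"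
    by (rule finite_subset) simp
  moreover have "betti I (Suc i) (Suc i + min_gen_degree I - 1) \<noteq> 0"
    unfolding betti using tor_dim_linear_strand[OF w(1-4) I_deg d w(5)] by simp
  ultimately show ?thesis unfolding lin_def by (intro Max_ge) simp_all
qed

section \<open>The ideal of order-preserving maps\<close>

lemma prod_var:
  "finite A \<Longrightarrow> (\<Prod>x\<in>A. var (h x)) = (single (\<Sum>x\<in>A. single (h x) 1) 1 :: ('v, 'k::field) mpoly)"
  by (induction A rule: finite_induct) (simp_all add: var_def mult_single)

lemma hcomp_prod_var:
  "finite A \<Longrightarrow> hcomp (int (card A)) (\<Prod>x\<in>A. var (h x)) = (\<Prod>x\<in>A. var (h x) :: ('v::finite, 'k::field) mpoly)"
proof (induction A rule: finite_induct)
  case empty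
  then show ?case using hcomp_sign[of 0] by simp
next
  case (insert a A)
  then show ?case using hcomp_eq_mult[OF insert.IH hcomp_var[of "h a"]] by simp
qed

lemma hom_ideal_0: "(0 :: ('p \<times> 'q, 'k) mpoly) \<in> hom_ideal"
  and hom_ideal_add: "f \<in> hom_ideal \<Longrightarrow> g \<in> hom_ideal \<Longrightarrow> f + g \<in> hom_ideal"
  and hom_ideal_mult: "f \<in> hom_ideal \<Longrightarrow> c * f \<in> hom_ideal"
  and u_mono_in_hom_ideal: "mono \<phi> \<Longrightarrow> (u_mono \<phi> :: ('p \<times> 'q, 'k) mpoly) \<in> hom_ideal"
  for f g c :: "('p::{finite,order} \<times> 'q::{finite,order}, 'k::field) mpoly" and \<phi> :: "'p \<Rightarrow> 'q"
proof -
  interpret module "(*) :: ('p \<times> 'q, 'k) mpoly \<Rightarrow> _" by (rule module_times)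
  show "(0 :: ('p \<times> 'q, 'k) mpoly) \<in> hom_ideal"
    "f \<in> hom_ideal \<Longrightarrow> g \<in> hom_ideal \<Longrightarrow> f + g \<in> hom_ideal"
    "f \<in> hom_ideal \<Longrightarrow> c * f \<in> hom_ideal"
    "mono \<phi> \<Longrightarrow> (u_mono \<phi> :: ('p \<times> 'q, 'k) mpoly) \<in> hom_ideal"
    unfolding hom_ideal_def ideal_gen_def
    by (auto intro: span_zero span_add span_scale span_base)
qed

lemma hom_ideal_induct [consumes 1, case_names zero step]:
  assumes "f \<in> (hom_ideal :: ('p::{finite,order} \<times> 'q::{finite,order}, 'k::field) mpoly set)"
    and "P 0" "\<And>c \<phi> g. mono \<phi> \<Longrightarrow> g \<in> hom_ideal \<Longrightarrow> P g \<Longrightarrow> P (c * u_mono \<phi> + g)"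
  shows "P f"
proof -
  interpret module "(*) :: ('p \<times> 'q, 'k) mpoly \<Rightarrow> _" by (rule module_times)
  have "f \<in> hom_ideal \<and> P f"
    using assms(1) unfolding hom_ideal_def ideal_gen_def
  proof (induction rule: span_induct_alt)
    case base
    then show ?case using assms(2) span_zero by simp
  next
    case (step c x y)
    then obtain \<phi> where "mono \<phi>" "x = u_mono \<phi>" by blast
    then show ?case
      using step assms(3)[of \<phi> y c] unfolding hom_ideal_def ideal_gen_def
      by (auto intro: span_add span_scale span_base)
  qed
  then show ?thesis ..
qed

lemma hcomp_u_mono:
  "hcomp (int (card (UNIV :: 'p set))) (u_mono \<phi>) = (u_mono \<phi> :: ('p::{finite,order} \<times> 'q::{finite,order}, 'k::field) mpoly)"
  unfolding u_mono_def by (rule hcomp_prod_var) simp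

lemma hcomp_hom_ideal:
  fixes f :: "('p::{finite,order} \<times> 'q::{finite,order}, 'k::field) mpoly"
  assumes "f \<in> hom_ideal"
  shows "hcomp n f \<in> hom_ideal"
  using assms
proof (induction rule: hom_ideal_induct)
  case zero
  then show ?case by (simp add: hom_ideal_0)
next
  case (step c \<phi> g)
  then show ?case
    by (simp add: hcomp_add hcomp_mult[OF hcomp_u_mono] hom_ideal_add hom_ideal_mult u_mono_in_hom_ideal)
qed

text \<open>The cofactor of a generator would have to contribute in negative degree.\<close>

lemma hcomp_hom_ideal_eq_0:
  fixes f :: "('p::{finite,order} \<times> 'q::{finite,order}, 'k::field) mpoly"
  assumes "f \<in> hom_ideal" "n < int (card (UNIV :: 'p set))"
  shows "hcomp n f = 0"
  using assms(1)
  by (induction rule: hom_ideal_induct)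
    (simp_all add: hcomp_add hcomp_mult[OF hcomp_u_mono] hcomp_neg assms(2))

lemma min_gen_degree_hom_ideal:
  "min_gen_degree (hom_ideal :: ('p::{finite,order} \<times> 'q::{finite,order}, 'k::field) mpoly set) = card (UNIV :: 'p set)"
proof -
  let ?I = "hom_ideal :: ('p \<times> 'q, 'k) mpoly set"
  have ge: "card (UNIV :: 'p set) \<le> mdeg m" if "m \<in> monomials_in ?I" for m
  proof (rule ccontr)
    assume "\<not> card (UNIV :: 'p set) \<le> mdeg m"
    then have "hcomp (int (mdeg m)) (single m 1 :: ('p \<times> 'q, 'k) mpoly) = 0"
      using that by (intro hcomp_hom_ideal_eq_0) (auto simp: monomials_in_def)
    then show False using hcomp_single[of m "1 :: 'k"] by (metis keys_single keys_zero insert_not_empty zero_neq_one)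
  qed
  \<comment> \<open>Any constant map is order-preserving; its monomial attains the lower bound
    \<open>ge\<close> on degrees and is therefore a minimal generator.\<close>
  define \<phi> :: "'p \<Rightarrow> 'q" where "\<phi> = (\<lambda>_. undefined)"
  define m where "m = (\<Sum>p\<in>UNIV. single (p, \<phi> p) (1::nat))"
  have u: "u_mono \<phi> = (single m 1 :: ('p \<times> 'q, 'k) mpoly)"
    by (simp add: u_mono_def prod_var m_def)
  have "mono \<phi>" by (simp add: \<phi>_def mono_def)
  then have m: "m \<in> monomials_in ?I"
    using u_mono_in_hom_ideal[of \<phi>, where 'k = 'k] by (simp add: monomials_in_def u)
  have deg: "mdeg m = card (UNIV :: 'p set)"
    using hcomp_u_mono[of \<phi>, where 'k = 'k] by (simp add: u hcomp_eq_iff)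
  have "m \<in> min_gens ?I"
    unfolding min_gens_def
  proof (intro CollectI conjI ballI impI m)
    fix m' assume m': "m' \<in> monomials_in ?I" "\<exists>e. m = m' + e"
    then obtain e where e: "m = m' + e" by blast
    then have "mdeg e = 0" using ge[OF m'(1)] deg by (simp add: mdeg_add)
    then show "m' = m" using e by (simp add: mdeg_eq_0_iff)
  qed
  then show ?thesis
    unfolding min_gen_degree_def using deg ge
    by (intro Least_equality) (auto simp: min_gens_def)
qed

section \<open>A Koszul cycle on an antichain\<close>

lemma hcomp_kos:
  assumes "\<And>T. hcomp n (z T) = z T"
  shows "hcomp (n + 1) (kos W z T) = kos W z T"
  unfolding kos_def hcomp_sum
  by (intro sum.cong refl) (metis assms hcomp_eq_mult hcomp_ksgn_var add.commute)

lemma kos_nonzero: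
  assumes "kos W z T \<noteq> 0"
  obtains v where "v \<in> W" "v \<notin> T" "z (insert v T) \<noteq> 0"
proof -
  obtain v where "v \<in> W - T" "ksgn v T * var v * z (insert v T) \<noteq> 0"
    using assms unfolding kos_def by (meson sum.not_neutral_contains_not_neutral)
  then show thesis by (intro that[of v]) auto
qed

lemma ksgn_cases: "ksgn v T = (1::'r::comm_ring_1) \<or> ksgn v T = (-1::'r)"
  unfolding ksgn_def by (cases "even (card {u \<in> T. to_nat u < to_nat v})") auto

text \<open>The product of the cycles \<open>\<partial>(\<And>\<^sub>q e\<^sub>p\<^sub>,\<^sub>q)\<close> over the entries \<open>p\<close> of the list, times \<open>M\<close>.\<close>

fun block_cycle ::
    "('p::finite \<times> 'q::finite) set \<Rightarrow> 'q set \<Rightarrow> ('p \<times> 'q, 'k::field) mpoly \<Rightarrow> 'p list \<Rightarrow>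
     ('p \<times> 'q) set \<Rightarrow> ('p \<times> 'q, 'k) mpoly" where
  "block_cycle X R M [] = (\<lambda>T. if T = X then M else 0)"
| "block_cycle X R M (p # ps) = kos ({p} \<times> R) (block_cycle X R M ps)"

text \<open>The differential of block \<open>p\<close> anticommutes past the other blocks until it
  meets its own copy, where \<open>kos_kos\<close> applies.\<close>

lemma block_cycle_kos_block: "p \<in> set ps \<Longrightarrow> kos ({p} \<times> R) (block_cycle X R M ps) T = 0"
proof (induction ps arbitrary: T)
  case (Cons p' ps)
  show ?case
  proof (cases "p = p'")
    case True
    then show ?thesis by (simp add: kos_kos)
  next
    case False
    then have "kos ({p} \<times> R) (block_cycle X R M (p' # ps)) T =
        - kos ({p'} \<times> R) (kos ({p} \<times> R) (block_cycle X R M ps)) T"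
      by (simp, intro kos_anticommute) auto
    also have "\<dots> = 0" using Cons False by (simp add: kos_def)
    finally show ?thesis .
  qed
qed simp

lemma block_cycle_support:
  "block_cycle X R M ps T \<noteq> 0 \<Longrightarrow> T \<subseteq> X \<and> card T + length ps = card X"
proof (induction ps arbitrary: T)
  case Nil
  then show ?case by (auto split: if_splits)
next
  case (Cons p ps)
  from Cons.prems have "kos ({p} \<times> R) (block_cycle X R M ps) T \<noteq> 0" by simp
  then obtain v where v: "v \<notin> T" "block_cycle X R M ps (insert v T) \<noteq> 0"
    by (rule kos_nonzero)
  from Cons.IH[OF v(2)] v(1) show ?case by simp
qed

lemma block_cycle_homogeneous:
  assumes "hcomp n M = M"
  shows "hcomp (n + int (length ps)) (block_cycle X R M ps T) = block_cycle X R M ps T"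
proof (induction ps arbitrary: T)
  case (Cons p ps)
  then show ?case using hcomp_kos[of "n + int (length ps)" "block_cycle X R M ps"]
    by (simp add: algebra_simps)
qed (simp add: assms)

text \<open>Variables outside \<open>A \<times> R\<close> contribute nothing, by the support, and
  the others split into blocks that vanish separately.\<close>

lemma block_cycle_kos:
  assumes "set ps = A"
  shows "kos UNIV (block_cycle (A \<times> R) R M ps) T = 0"
proof -
  let ?w = "block_cycle (A \<times> R) R M ps"
  have "kos UNIV ?w T = kos (A \<times> R) ?w T"
    unfolding kos_def
  proof (rule sum.mono_neutral_right)
    show "\<forall>v\<in>UNIV - T - (A \<times> R - T). ksgn v T * var v * ?w (insert v T) = 0"
    proof
      fix v assume "v \<in> UNIV - T - (A \<times> R - T)"
      then have "?w (insert v T) = 0" using block_cycle_support by fastforce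
      then show "ksgn v T * var v * ?w (insert v T) = 0" by simp
    qed
  qed auto
  also have "A \<times> R - T = (\<Union>p\<in>A. {p} \<times> R - T)" by auto
  then have "kos (A \<times> R) ?w T = (\<Sum>p\<in>A. kos ({p} \<times> R) ?w T)"
    unfolding kos_def by (simp only:) (rule sum.UNION_disjoint; auto)
  also have "\<dots> = 0" using assms by (simp add: block_cycle_kos_block)
  finally show ?thesis .
qed

text \<open>When the same \<open>q\<close> is removed from every block, each contraction has exactly
  one term. The coefficient is a single monomial up to sign, and nothing can cancel.\<close>

lemma block_cycle_nonzero:
  fixes A :: "'p::finite set" and R :: "'q::finite set"
  assumes "distinct ps" "set ps \<subseteq> A" "q \<in> R"
  shows "block_cycle (A \<times> R) R (single m (1 :: 'k::field)) ps (A \<times> R - set ps \<times> {q}) \<noteq> 0"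
proof -
  have "\<exists>m' (c :: 'k). (c = 1 \<or> c = -1) \<and>
      block_cycle (A \<times> R) R (single m 1) ps (A \<times> R - set ps \<times> {q}) = single m' c"
    using assms
  proof (induction ps)
    case (Cons p ps)
    let ?T = "A \<times> R - set (p # ps) \<times> {q}"
    have *: "{p} \<times> R - ?T = {(p, q)}" "insert (p, q) ?T = A \<times> R - set ps \<times> {q}"
      using Cons.prems by auto
    have "distinct ps" "set ps \<subseteq> A" using Cons.prems by auto
    from Cons.IH[OF this Cons.prems(3)] obtain m' and c :: 'k where IH: "c = 1 \<or> c = -1"
      "block_cycle (A \<times> R) R (single m 1) ps (A \<times> R - set ps \<times> {q}) = single m' c"
      by blast
    have "block_cycle (A \<times> R) R (single m 1) (p # ps) ?T = ksgn (p, q) ?T * var (p, q) * single m' c"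
      unfolding block_cycle.simps kos_def *(1) by (simp only: sum.insert finite.emptyI empty_iff
        not_False_eq_True sum.empty add_0_right *(2) IH(2))
    also have "\<dots> = single (single (p, q) 1 + m') (ksgn (p, q) ?T * c)"
      by (simp add: ksgn_conv_single[where 'w = "'p \<times> 'q"] var_def mult_single)
    finally show ?case using IH(1) ksgn_cases[of "(p, q)" ?T, where 'r = 'k] by fastforce
  qed auto
  then show ?thesis by (metis keys_single keys_zero insert_not_empty zero_neq_one neg_equal_0_iff_equal)
qed

text \<open>Contracting in block \<open>p\<close> multiplies by some \<open>var (p, q)\<close> with
  \<open>q\<close> in \<open>R\<close>, which extends the map \<open>f\<close> by the value
  \<open>q\<close> at \<open>p\<close>.\<close>

lemma block_cycle_in_span:
  fixes M :: "('p::finite \<times> 'q::finite, 'k::field) mpoly"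
  assumes "distinct ps"
  shows "block_cycle X R M ps T \<in> ideal_gen {M * (\<Prod>p\<in>set ps. var (p, f p)) | f. \<forall>p\<in>set ps. f p \<in> R}"
proof -
  interpret module "(*) :: ('p \<times> 'q, 'k) mpoly \<Rightarrow> _" by (rule module_times)
  let ?S = "\<lambda>ps. {M * (\<Prod>p\<in>set ps. var (p, f p)) | f. \<forall>p\<in>set ps. f p \<in> R}"
  have "block_cycle X R M ps T \<in> span (?S ps)"
    using assms
  proof (induction ps arbitrary: T)
    case Nil
    then show ?case by (auto intro: span_base span_zero)
  next
    case (Cons p ps)
    have step: "c * var (p, q) * x \<in> span (?S (p # ps))" if x: "x \<in> span (?S ps)" and q: "q \<in> R" for c q x
      using x
    proof (induction rule: span_induct_alt)
      case base
      then show ?case by (simp add: span_zero)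
    next
      case (step c' x y)
      then obtain f where f: "x = M * (\<Prod>p\<in>set ps. var (p, f p))" "\<forall>p\<in>set ps. f p \<in> R" by blast
      have "(\<Prod>r\<in>set ps. var (r, (f(p := q)) r)) = (\<Prod>r\<in>set ps. var (r, f r) :: ('p \<times> 'q, 'k) mpoly)"
        using Cons.prems by (intro prod.cong) auto
      then have "var (p, q) * x = M * (\<Prod>r\<in>set (p # ps). var (r, (f(p := q)) r))"
        using Cons.prems by (simp add: f(1) mult.left_commute)
      moreover have "\<forall>r\<in>set (p # ps). (f(p := q)) r \<in> R" using f(2) q by simp
      ultimately have "var (p, q) * x \<in> ?S (p # ps)" by blast
      then have "(c * c') * (var (p, q) * x) \<in> span (?S (p # ps))" by (intro span_scale span_base)
      moreover have "c * var (p, q) * (c' * x + y) = (c * c') * (var (p, q) * x) + c * var (p, q) * y"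
        by (simp only: distrib_left ac_simps)
      ultimately show ?case using step.IH by (simp only: span_add)
    qed
    show ?case
      unfolding block_cycle.simps kos_def
    proof (rule span_sum)
      fix v assume "v \<in> {p} \<times> R - T"
      then obtain q where v: "v = (p, q)" "q \<in> R" by blast
      show "ksgn v T * var v * block_cycle X R M ps (insert v T) \<in> span (?S (p # ps))"
        unfolding v(1) using Cons.prems by (intro step[OF Cons.IH v(2)]) simp
    qed
  qed
  then show ?thesis by (simp add: ideal_gen_def)
qed

text \<open>The common core of the three bounds. By \<open>mono\<close>, the values on
  \<open>A\<close> may be chosen freely in \<open>R\<close> once \<open>g\<close> is fixed
  elsewhere, so the coefficients of the block cycle are combinations of generators of the
  ideal.\<close>

lemma lin_ge_free_values:
  fixes A :: "'p::{finite,order} set" and R :: "'q::{finite,order} set" and g :: "'p \<Rightarrow> 'q"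
  assumes R: "q \<in> R" and mono: "\<And>f. \<forall>p\<in>A. f p \<in> R \<Longrightarrow> mono (\<lambda>p. if p \<in> A then f p else g p)"
  shows "card A * (card R - 1) + 1 \<le> lin (hom_ideal :: ('p \<times> 'q, 'k::field) mpoly set)"
proof -
  let ?I = "hom_ideal :: ('p \<times> 'q, 'k) mpoly set"
  interpret module "(*) :: ('p \<times> 'q, 'k) mpoly \<Rightarrow> _" by (rule module_times)
  obtain ps where ps: "set ps = A" "distinct ps" using finite_distinct_list[of A] by auto
  define M :: "('p \<times> 'q, 'k) mpoly" where "M = (\<Prod>p\<in>-A. var (p, g p))"
  define w where "w = block_cycle (A \<times> R) R M ps"
  have len: "length ps = card A" using ps distinct_card by fastforce
  have d: "min_gen_degree ?I = card (UNIV :: 'p set)" by (rule min_gen_degree_hom_ideal)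
  \<comment> \<open>Nonemptiness of \<open>R\<close> makes \<open>card R - 1\<close> a true
    difference. Each block loses one variable, leaving exterior degree
    \<open>card A * (card R - 1)\<close>.\<close>
  have "card R > 0" using R by (auto simp: card_gt_0_iff)
  then have cardX: "card (A \<times> R) = card A * (card R - 1) + length ps"
    by (cases "card R") (simp_all add: len card_cartesian_product)
  have "M * (\<Prod>p\<in>A. var (p, f p)) \<in> ?I" if f: "\<forall>p\<in>A. f p \<in> R" for f
  proof -
    have "M * (\<Prod>p\<in>A. var (p, f p)) =
        (\<Prod>p\<in>-A. var (p, if p \<in> A then f p else g p)) * (\<Prod>p\<in>A. var (p, if p \<in> A then f p else g p))"
      unfolding M_def by (intro arg_cong2[of _ _ _ _ "(*)"] prod.cong) auto
    also have "\<dots> = u_mono (\<lambda>p. if p \<in> A then f p else g p)"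
      unfolding u_mono_def by (subst prod.union_disjoint[symmetric]) (auto simp: Un_commute)
    finally show ?thesis using u_mono_in_hom_ideal[OF mono[OF f]] by simp
  qed
  then have "ideal_gen {M * (\<Prod>p\<in>set ps. var (p, f p)) | f. \<forall>p\<in>set ps. f p \<in> R} \<subseteq> ?I"
    unfolding ideal_gen_def ps(1)
    by (intro span_minimal) (auto simp: subspace_def hom_ideal_0 hom_ideal_add hom_ideal_mult)
  then have w_I: "w T \<in> ?I" for T
    using block_cycle_in_span[OF ps(2)] unfolding w_def by blast
  have "hcomp (int (card (- A))) M = M"
    unfolding M_def by (rule hcomp_prod_var) simp
  moreover have "int (card (- A)) + int (length ps) = int (card (UNIV :: 'p set))"
    by (simp add: len Compl_eq_Diff_UNIV card_Diff_subset card_mono of_nat_diff)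
  ultimately have w_deg: "hcomp (int (card (UNIV :: 'p set))) (w T) = w T" for T
    unfolding w_def by (metis block_cycle_homogeneous)
  have w_0: "w T = 0" if "card T \<noteq> card A * (card R - 1)" for T
    using block_cycle_support[of "A \<times> R" R M ps T] that cardX by (auto simp: w_def)
  have "M = single (\<Sum>p\<in>-A. single (p, g p) 1) 1" by (simp add: M_def prod_var)
  then have "w (A \<times> R - set ps \<times> {q}) \<noteq> 0"
    unfolding w_def using block_cycle_nonzero[OF ps(2) _ R, of A] ps(1) by simp
  moreover have "kos UNIV w T = 0" for T by (simp add: w_def block_cycle_kos[OF ps(1)])
  ultimately have "Suc (card A * (card R - 1)) \<le> lin ?I"
    by (intro le_lin[where w = w] hom_ideal_0 hom_ideal_add hom_ideal_mult hcomp_hom_ideal w_I w_0)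
      (simp_all add: d hcomp_hom_ideal_eq_0 w_deg Suc_le_eq card_gt_0_iff)
  then show ?thesis by simp
qed

text \<open>By finiteness every element lies above a minimal one, so a unique minimal element is
  least.\<close>

lemma unique_minimal_le:
  fixes A :: "'a::{finite,order} set"
  assumes "\<exists>!m. m \<in> minimal_elems A"
  obtains m where "m \<in> A" "\<And>x. x \<in> A \<Longrightarrow> m \<le> x"
proof -
  obtain m where m: "m \<in> minimal_elems A" "\<And>x. x \<in> minimal_elems A \<Longrightarrow> x = m" using assms by blast
  have "m \<le> x" if x: "x \<in> A" for x
  proof -
    obtain y where "y \<in> A" "y \<le> x" "\<forall>z\<in>A. z \<le> y \<longrightarrow> y = z"
      using finite_has_minimal2[OF finite x] by blast
    then show ?thesis using m(2)[of y] by (auto simp: minimal_elems_def)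
  qed
  then show thesis using that m(1) by (auto simp: minimal_elems_def)
qed

lemma unique_maximal_ge:
  fixes A :: "'a::{finite,order} set"
  assumes "\<exists>!m. m \<in> maximal_elems A"
  obtains m where "m \<in> A" "\<And>x. x \<in> A \<Longrightarrow> x \<le> m"
proof -
  obtain m where m: "m \<in> maximal_elems A" "\<And>x. x \<in> maximal_elems A \<Longrightarrow> x = m" using assms by blast
  have "x \<le> m" if x: "x \<in> A" for x
  proof -
    obtain y where "y \<in> A" "x \<le> y" "\<forall>z\<in>A. y \<le> z \<longrightarrow> y = z"
      using finite_has_maximal2[OF finite x] by blast
    then show ?thesis using m(2)[of y] by (auto simp: maximal_elems_def)
  qed
  then show thesis using that m(1) by (auto simp: maximal_elems_def)
qed

theorem proposition4p5:
  fixes Q' :: "'q::{finite,order} set"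
  shows
    "((\<exists>!m. m \<in> minimal_elems Q') \<longrightarrow>
        lin (hom_ideal :: ('p::{finite,order} \<times> 'q, 'k::field) mpoly set)
          \<ge> card (maximal_elems (UNIV :: 'p set)) * (card Q' - 1) + 1) \<and>
     ((\<exists>!m. m \<in> maximal_elems Q') \<longrightarrow>
        lin (hom_ideal :: ('p \<times> 'q, 'k) mpoly set)
          \<ge> card (minimal_elems (UNIV :: 'p set)) * (card Q' - 1) + 1) \<and>
     (bounded_poset Q' \<longrightarrow>
        lin (hom_ideal :: ('p \<times> 'q, 'k) mpoly set)
          \<ge> max_antichain_card (UNIV :: 'p set) * (card Q' - 1) + 1)"
proof (intro conjI impI)
  assume "\<exists>!m. m \<in> minimal_elems Q'"
  then obtain m where m: "m \<in> Q'" "\<And>x. x \<in> Q' \<Longrightarrow> m \<le> x" by (rule unique_minimal_le) blast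
  show "lin (hom_ideal :: ('p \<times> 'q, 'k) mpoly set)
      \<ge> card (maximal_elems (UNIV :: 'p set)) * (card Q' - 1) + 1"
  \<comment> \<open>Everything outside the maximal elements goes to the bottom of \<open>Q'\<close>.
    A maximal \<open>x\<close> with \<open>x \<le> y\<close> equals \<open>y\<close>, so free values
    are never compared with one another or with \<open>m\<close> above them.\<close>
  proof (rule lin_ge_free_values[where g = "\<lambda>_. m", OF m(1)], rule monoI)
    fix f :: "'p \<Rightarrow> 'q" and x y :: 'p
    assume f: "\<forall>p\<in>maximal_elems UNIV. f p \<in> Q'" and "x \<le> y"
    show "(if x \<in> maximal_elems UNIV then f x else m) \<le> (if y \<in> maximal_elems UNIV then f y else m)"
    proof (cases "x \<in> maximal_elems UNIV")
      case True
      then have "x = y" using \<open>x \<le> y\<close> by (auto simp: maximal_elems_def)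
      then show ?thesis by simp
    qed (use f m in auto)
  qed
next
  assume "\<exists>!m. m \<in> maximal_elems Q'"
  then obtain m where m: "m \<in> Q'" "\<And>x. x \<in> Q' \<Longrightarrow> x \<le> m" by (rule unique_maximal_ge) blast
  show "lin (hom_ideal :: ('p \<times> 'q, 'k) mpoly set)
      \<ge> card (minimal_elems (UNIV :: 'p set)) * (card Q' - 1) + 1"
  \<comment> \<open>Dually, everything outside the minimal elements goes to the top of
    \<open>Q'\<close>.\<close>
  proof (rule lin_ge_free_values[where g = "\<lambda>_. m", OF m(1)], rule monoI)
    fix f :: "'p \<Rightarrow> 'q" and x y :: 'p
    assume f: "\<forall>p\<in>minimal_elems UNIV. f p \<in> Q'" and "x \<le> y"
    show "(if x \<in> minimal_elems UNIV then f x else m) \<le> (if y \<in> minimal_elems UNIV then f y else m)"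
    proof (cases "y \<in> minimal_elems UNIV")
      case True
      then have "x = y" using \<open>x \<le> y\<close> by (auto simp: minimal_elems_def)
      then show ?thesis by simp
    qed (use f m in auto)
  qed
next
  assume b: "bounded_poset Q'"
  obtain m where m: "m \<in> Q'" "\<And>x. x \<in> Q' \<Longrightarrow> m \<le> x"
    using b unfolding bounded_poset_def by (elim conjE unique_minimal_le) blast
  obtain M where M: "M \<in> Q'" "\<And>x. x \<in> Q' \<Longrightarrow> x \<le> M"
    using b unfolding bounded_poset_def by (elim conjE unique_maximal_ge) blast
  have "max_antichain_card (UNIV :: 'p set) \<in> {card A | A. A \<subseteq> (UNIV :: 'p set) \<and> antichain A}"
    unfolding max_antichain_card_def by (rule Max_in) (auto intro: exI[of _ "{}"] simp: antichain_def)
  then obtain A :: "'p set" where A: "antichain A" "max_antichain_card (UNIV :: 'p set) = card A" by auto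
  \<comment> \<open>Elements strictly below \<open>A\<close> go to \<open>m\<close>, and this set is
    closed downwards outside \<open>A\<close>. An element \<open>y\<close> outside \<open>A\<close>
    but above some \<open>x\<close> in \<open>A\<close> cannot lie below \<open>A\<close>, or the
    antichain condition would force \<open>y = x\<close>; so it goes to \<open>M\<close>.\<close>
  have "mono (\<lambda>p. if p \<in> A then f p else if \<exists>a\<in>A. p \<le> a then m else M)"
    if f: "\<forall>p\<in>A. f p \<in> Q'" for f
  proof (rule monoI)
    fix x y :: 'p assume "x \<le> y"
    show "(if x \<in> A then f x else if \<exists>a\<in>A. x \<le> a then m else M)
      \<le> (if y \<in> A then f y else if \<exists>a\<in>A. y \<le> a then m else M)"
      using \<open>x \<le> y\<close> A(1) f m M unfolding antichain_def
      by (smt (verit, best) order.trans order.antisym order.refl)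
  qed
  then show "lin (hom_ideal :: ('p \<times> 'q, 'k) mpoly set)
      \<ge> max_antichain_card (UNIV :: 'p set) * (card Q' - 1) + 1"
    unfolding A(2) by (intro lin_ge_free_values[OF m(1)])
qed

end
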